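(* Let $m\ge3$ be odd and $N=2^{m+1}$. The graph $\Gamma_m$ has valencies $v_0=1$, $v_1=N$, $v_2=\binom N2$, $v_3=\frac{N(N-2)}{2}$, $v_4=\frac{N-2}{2}$, and intersection numbers $b_0=N$, $c_1=1$, $b_1=N-1$, $c_2=2$, $b_2=N-2$, $c_3=N-1$, $b_3=1$, $c_4=N$; furthermore $a_j=0$ for $j=0,1,2,3,4$.
   Context: Let $n=2^m-1$, $h_2(X)\in\mathbb Z_2[X]$ primitive irreducible of degree $m$, $h(X)\in\mathbb Z_4[X]$ the unique monic degree-$m$ polynomial with $h\equiv h_2\pmod 2$ and $h\mid X^n-1$ in $\mathbb Z_4[X]$. $\mathcal P\subseteq\mathbb Z_4^{N/2}$ is obtained from the cyclic code of length $n$ over $\mathbb Z_4$ generated by $h(X)$ by adjoining a zero-sum check coordinate $c_\infty=-\sum c_t$. Gray map: $\beta(0,1,2,3)=(0,0,1,1)$, $\gamma(0,1,2,3)=(0,1,1,0)$ componentwise, $\phi(c)=(\beta(c),\gamma(c))$. $\Gamma_m$ is the graph whose vertices are the images under $\phi$ of the cosets $x+\mathcal P$ in $\mathbb Z_4^{N/2}$, two being adjacent when they come from cosets $x+\mathcal P$, $y+\mathcal P$ with $x-y+\mathcal P$ of minimal Lee weight 1 (Lee weights of $0,1,2,3$ are $0,1,2,1$). $\Gamma_m$ is distance regular of diameter 4. The valency $v_j$ is the number of vertices at distance $j$ from a given vertex; for vertices $u,w$ at distance $j$, $c_j$, $a_j$, $b_j$ are the numbers of neighbours of $w$ at distance $j-1$,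 $j$, $j+1$ from $u$ respectively. *)

theory Defs
  imports
    "HOL-Library.Numeral_Type"
    "HOL-Library.Z2"
    "HOL-Library.Function_Algebras"
    "HOL-Library.Set_Algebras"
    "HOL-Computational_Algebra.Computational_Algebra"
begin

text \<open>
  The ring of integers modulo 4 is the numeral type \<open>4\<close>, the field with two elements is \<open>bit\<close>.
  Reduction modulo 2, the components of the Gray map and the Lee weight are given by their
  tables of values on 0, 1, 2, 3.
\<close>

definition red2 :: "4 \<Rightarrow> bit" where
  "red2 a = (if a = 1 \<or> a = 3 then 1 else 0)"

definition gray_beta :: "4 \<Rightarrow> bit" where
  "gray_beta a = (if a = 2 \<or> a = 3 then 1 else 0)"

definition gray_gamma :: "4 \<Rightarrow> bit" where
  "gray_gamma a = (if a = 1 \<or> a = 2 then 1 else 0)"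

definition lee :: "4 \<Rightarrow> nat" where
  "lee a = (if a = 0 then 0 else if a = 2 then 2 else 1)"

text \<open>
  Words of length \<open>L\<close> are functions on \<open>nat\<close> that vanish outside \<open>{..<L}\<close>; sums and
  differences of words are pointwise.
\<close>

definition words :: "nat \<Rightarrow> (nat \<Rightarrow> 4) set" where
  "words L = {c. \<forall>t\<ge>L. c t = 0}"

definition lee_weight :: "nat \<Rightarrow> (nat \<Rightarrow> 4) \<Rightarrow> nat" where
  "lee_weight L c = (\<Sum>t<L. lee (c t))"

definition min_lee_weight :: "nat \<Rightarrow> (nat \<Rightarrow> 4) set \<Rightarrow> nat" where
  "min_lee_weight L C = (INF c\<in>C. lee_weight L c)"

definition gray :: "(nat \<Rightarrow> 4) \<Rightarrow> (nat \<Rightarrow> bit) \<times> (nat \<Rightarrow> bit)" where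
  "gray c = (gray_beta \<circ> c, gray_gamma \<circ> c)"

text \<open>
  The residue class of \<open>X\<close> modulo the irreducible polynomial \<open>p\<close> is a primitive element of the
  field of residue classes: every nonzero class is a power of it.
\<close>

definition primitive_irreducible :: "bit poly \<Rightarrow> bool" where
  "primitive_irreducible p \<longleftrightarrow>
     irreducible p \<and> (\<forall>f. \<not> p dvd f \<longrightarrow> (\<exists>k. p dvd f - monom 1 k))"

text \<open>
  The cyclic code is the ideal generated by \<open>g\<close> in the quotient by \<open>X\<^sup>n - 1\<close>, a word being
  identified with the class of the polynomial having its entries as coefficients.
\<close>

definition cyclic_code :: "nat \<Rightarrow> 4 poly \<Rightarrow> (nat \<Rightarrow> 4) set" where
  "cyclic_code n g =
     {c \<in> words n. \<exists>q. monom 1 n - 1 dvd (\<Sum>t<n. monom (c t) t) - g * q}"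

text \<open>The check coordinate, which has index \<open>\<infinity>\<close> in the literature, gets index \<open>n\<close> here.\<close>

definition adjoin_check :: "nat \<Rightarrow> (nat \<Rightarrow> 4) \<Rightarrow> nat \<Rightarrow> 4" where
  "adjoin_check n c = c(n := - (\<Sum>t<n. c t))"

definition preparata :: "nat \<Rightarrow> 4 poly \<Rightarrow> (nat \<Rightarrow> 4) set" where
  "preparata m h = adjoin_check (2 ^ m - 1) ` cyclic_code (2 ^ m - 1) h"

definition gamma_verts :: "nat \<Rightarrow> 4 poly \<Rightarrow> ((nat \<Rightarrow> bit) \<times> (nat \<Rightarrow> bit)) set set" where
  "gamma_verts m h = {gray ` (x +o preparata m h) | x. x \<in> words (2 ^ m)}"

definition gamma_adj ::
  "nat \<Rightarrow> 4 poly \<Rightarrow> ((nat \<Rightarrow> bit) \<times> (nat \<Rightarrow> bit)) set \<Rightarrow>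
   ((nat \<Rightarrow> bit) \<times> (nat \<Rightarrow> bit)) set \<Rightarrow> bool" where
  "gamma_adj m h u w \<longleftrightarrow>
     (\<exists>x\<in>words (2 ^ m). \<exists>y\<in>words (2 ^ m).
        u = gray ` (x +o preparata m h) \<and> w = gray ` (y +o preparata m h) \<and>
        min_lee_weight (2 ^ m) ((x - y) +o preparata m h) = 1)"

text \<open>
  A graph is given by its vertex set \<open>V\<close> and an adjacency relation that holds between elements
  of \<open>V\<close> only. Two vertices are at distance \<open>j\<close> when \<open>j\<close> is the least length of a walk
  between them, so that vertices of different components are at no distance.
\<close>

definition at_dist :: "('v \<Rightarrow> 'v \<Rightarrow> bool) \<Rightarrow> nat \<Rightarrow> 'v \<Rightarrow> 'v \<Rightarrow> bool" where
  "at_dist adj j u w \<longleftrightarrow> (adj ^^ j) u w \<and> (\<forall>i<j. \<not> (adj ^^ i) u w)"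

definition has_diameter :: "'v set \<Rightarrow> ('v \<Rightarrow> 'v \<Rightarrow> bool) \<Rightarrow> nat \<Rightarrow> bool" where
  "has_diameter V adj d \<longleftrightarrow>
     (\<forall>u\<in>V. \<forall>w\<in>V. \<exists>j\<le>d. at_dist adj j u w) \<and> (\<exists>u\<in>V. \<exists>w\<in>V. at_dist adj d u w)"

definition has_valency :: "'v set \<Rightarrow> ('v \<Rightarrow> 'v \<Rightarrow> bool) \<Rightarrow> nat \<Rightarrow> nat \<Rightarrow> bool" where
  "has_valency V adj j k \<longleftrightarrow> (\<forall>u\<in>V. card {w\<in>V. at_dist adj j u w} = k)"

definition has_c :: "'v set \<Rightarrow> ('v \<Rightarrow> 'v \<Rightarrow> bool) \<Rightarrow> nat \<Rightarrow> nat \<Rightarrow> bool" where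
  "has_c V adj j k \<longleftrightarrow>
     (\<forall>u\<in>V. \<forall>w\<in>V. at_dist adj j u w \<longrightarrow>
        card {z\<in>V. adj w z \<and> (\<exists>i. i + 1 = j \<and> at_dist adj i u z)} = k)"

definition has_a :: "'v set \<Rightarrow> ('v \<Rightarrow> 'v \<Rightarrow> bool) \<Rightarrow> nat \<Rightarrow> nat \<Rightarrow> bool" where
  "has_a V adj j k \<longleftrightarrow>
     (\<forall>u\<in>V. \<forall>w\<in>V. at_dist adj j u w \<longrightarrow> card {z\<in>V. adj w z \<and> at_dist adj j u z} = k)"

definition has_b :: "'v set \<Rightarrow> ('v \<Rightarrow> 'v \<Rightarrow> bool) \<Rightarrow> nat \<Rightarrow> nat \<Rightarrow> bool" where
  "has_b V adj j k \<longleftrightarrow>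
     (\<forall>u\<in>V. \<forall>w\<in>V. at_dist adj j u w \<longrightarrow> card {z\<in>V. adj w z \<and> at_dist adj (j + 1) u z} = k)"

end

theory Submission
  imports Defs "HOL-Library.Product_Plus" "HOL-Number_Theory.Cong"
begin

text \<open>
  The syndrome \<open>x \<mapsto> (\<Sum> x\<^sub>t, \<Sum> x\<^sub>t X\<^sup>t mod h)\<close> identifies the cosets of the Preparata code with
  \<open>G = \<int>\<^sub>4 \<times> R\<close>, where \<open>R = \<int>\<^sub>4[X]/(h)\<close>, and turns \<open>\<Gamma>\<^sub>m\<close> into the Cayley graph of \<open>G\<close> with
  connection set \<open>S = \<plusminus>({1} \<times> T)\<close>, where \<open>T\<close> consists of 0 and the powers of \<open>X\<close>.
  The graph is bipartite with even part \<open>E = {0, 2} \<times> R\<close>. Reduction modulo 2 maps \<open>T\<close> bijectively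
  onto \<open>R/2R\<close>, so every odd element has exactly one neighbour in \<open>K = {0} \<times> 2R\<close>. For odd \<open>m\<close> a sum
  of two elements of \<open>S\<close> outside \<open>K\<close> has at most two representations as such a sum, and by counting it
  has exactly two and all of \<open>E - K\<close> is reached. Hence the vertices at distance
  0, 1, 2, 3, 4 from 0 are \<open>{0}\<close>, \<open>S\<close>, \<open>E - K\<close>, \<open>G - E - S\<close>, \<open>K - {0}\<close>, and the parameters
  can be read off.
\<close>

subsection \<open>Antipodal bipartite Cayley graphs of diameter 4\<close>

lemma at_dist_iff_level:
  fixes lev :: "'v \<Rightarrow> nat"
  assumes adj_verts: "\<And>w z. adj w z \<Longrightarrow> w \<in> V \<and> z \<in> V"
    and u: "u \<in> V"
    and zero: "\<And>w. w \<in> V \<Longrightarrow> lev w = 0 \<longleftrightarrow> w = u"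
    and step: "\<And>w z. adj w z \<Longrightarrow> lev z \<le> Suc (lev w)"
    and pred: "\<And>w j. w \<in> V \<Longrightarrow> lev w = Suc j \<Longrightarrow> \<exists>z. adj z w \<and> lev z = j"
    and w: "w \<in> V"
  shows "at_dist adj j u w \<longleftrightarrow> lev w = j"
proof -
  have le: "lev w \<le> i" if "(adj ^^ i) u w" for i w
    using that
  proof (induction i arbitrary: w)
    case 0
    then show ?case using zero[OF u] by simp
  next
    case (Suc i)
    then obtain z where "(adj ^^ i) u z" "adj z w" by auto
    then show ?case using Suc.IH step by fastforce
  qed
  have walk: "(adj ^^ i) u w" if "lev w = i" "w \<in> V" for i w
    using that
  proof (induction i arbitrary: w)
    case 0
    then show ?case using zero by simp
  next
    case (Suc i)
    then obtain z where "adj z w" "lev z = i" using pred by blast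
    then show ?case using Suc.IH adj_verts by auto
  qed
  show ?thesis
  proof
    assume *: "at_dist adj j u w"
    then have "lev w \<le> j" using le by (auto simp: at_dist_def)
    moreover have "\<not> lev w < j" using * walk[OF refl w] by (auto simp: at_dist_def)
    ultimately show "lev w = j" by simp
  next
    assume "lev w = j"
    then show "at_dist adj j u w"
      using walk[OF _ w] le by (fastforce simp: at_dist_def)
  qed
qed

text \<open>What the graph argument needs of the syndrome group. \<open>E\<close> is the even half
  of the bipartition and \<open>K\<close> the antipodal class of 0. By \<open>perfect\<close> the
  sets \<open>k - S\<close> with \<open>k\<close> in \<open>K\<close> tile the odd half. The last
  alternative in \<open>sidon\<close> reflects that s + s = (- s) + (- s) whenever 4 s = 0.
  Cardinalities are doubled to avoid division.\<close>

locale antipodal_cayley =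
  fixes G E K S :: "'g::ab_group_add set" and N :: nat
  assumes finite_G: "finite G"
    and card_S: "card S = N"
    and card_even: "2 * card E = N * N"
    and card_odd: "2 * card (G - E) = N * N"
    and zero_K: "0 \<in> K" and K_E: "K \<subseteq> E" and E_G: "E \<subseteq> G" and S_odd: "S \<subseteq> G - E"
    and diff_G: "\<And>x y. x \<in> G \<Longrightarrow> y \<in> G \<Longrightarrow> x - y \<in> G"
    and uminus_S: "\<And>s. s \<in> S \<Longrightarrow> - s \<in> S"
    and parity: "\<And>x s. x \<in> G \<Longrightarrow> s \<in> S \<Longrightarrow> x + s \<in> E \<longleftrightarrow> x \<notin> E"
    and perfect: "\<And>x. x \<in> G - E \<Longrightarrow> \<exists>!s. s \<in> S \<and> x + s \<in> K"
    and sidon: "\<And>s t s' t'. \<lbrakk>s \<in> S; t \<in> S; s' \<in> S; t' \<in> S; s + t = s' + t'; s + t \<noteq> 0\<rbrakk>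
        \<Longrightarrow> s' = s \<or> s' = t \<or> s = t \<and> s' = - s"
    and N_ge_4: "N \<ge> 4"
begin

lemma zero_G: "0 \<in> G" and zero_E: "0 \<in> E"
  using zero_K K_E E_G by auto

lemma uminus_G: "x \<in> G \<Longrightarrow> - x \<in> G"
  using diff_G[OF zero_G] by fastforce

lemma add_G: "x \<in> G \<Longrightarrow> y \<in> G \<Longrightarrow> x + y \<in> G"
  using diff_G[of x "- y"] uminus_G by simp

lemma S_G: "s \<in> S \<Longrightarrow> s \<in> G" and S_E: "s \<in> S \<Longrightarrow> s \<notin> E" and S_K: "s \<in> S \<Longrightarrow> s \<notin> K"
  using S_odd K_E by auto

lemma finite_S: "finite S"
  using finite_subset[OF S_odd] finite_G by simp

lemma uminus_S_iff: "- s \<in> S \<longleftrightarrow> s \<in> S"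
  using uminus_S by (metis minus_minus)

text \<open>Since \<open>s\<close> is odd, \<open>perfect\<close> allows one element of
  \<open>S\<close> that leads from \<open>s\<close> into \<open>K\<close>, and \<open>- s\<close>
  does so because 0 lies in \<open>K\<close>.\<close>

lemma add_S_in_K:
  assumes "s \<in> S" "t \<in> S" "s + t \<in> K"
  shows "t = - s"
proof -
  have "\<exists>!t. t \<in> S \<and> s + t \<in> K" using perfect S_odd assms(1) by blast
  moreover have "- s \<in> S \<and> s + (- s) \<in> K" using uminus_S zero_K assms(1) by simp
  ultimately show ?thesis using assms(2,3) by blast
qed

text \<open>Otherwise \<open>- s\<close> and \<open>x + s\<close> are members of \<open>S\<close>
  with sum \<open>x\<close> in \<open>K\<close>, hence mutually inverse by
  \<open>add_S_in_K\<close>, which forces \<open>x = 0\<close>.\<close>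

lemma K_plus_S_not_S:
  assumes "x \<in> K" "x \<noteq> 0" "s \<in> S"
  shows "x + s \<notin> S"
proof
  assume "x + s \<in> S"
  then have "x + s = - (- s)"
    using assms add_S_in_K[of "- s" "x + s"] by (simp add: uminus_S)
  then show False using assms by simp
qed

text \<open>By \<open>perfect\<close> every odd element is \<open>k - s\<close> for exactly one
  pair, so the odd half, of size N^2 / 2, has N times as many elements as \<open>K\<close>.\<close>

lemma two_card_K: "2 * card K = N"
proof -
  have "bij_betw (\<lambda>(s, k). k - s) (S \<times> K) (G - E)"
    unfolding bij_betw_def
  proof
    show "inj_on (\<lambda>(s, k). k - s) (S \<times> K)"
    proof (rule inj_onI, clarify)
      fix s k s' k'
      assume *: "s \<in> S" "k \<in> K" "s' \<in> S" "k' \<in> K" "k - s = k' - s'"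
      have "k + (- s) \<in> G - E"
        using * K_E E_G parity[of k "- s"] uminus_S add_G S_G by blast
      moreover have "k + (- s) + s \<in> K" "k + (- s) + s' \<in> K"
        using * by (simp_all add: algebra_simps)
      ultimately have "s = s'" using perfect * by blast
      then show "s = s' \<and> k = k'" using * by simp
    qed
    show "(\<lambda>(s, k). k - s) ` (S \<times> K) = G - E"
    proof (intro equalityI subsetI)
      fix x assume "x \<in> (\<lambda>(s, k). k - s) ` (S \<times> K)"
      then obtain s k where "s \<in> S" "k \<in> K" "x = k + (- s)" by auto
      then show "x \<in> G - E"
        using K_E E_G parity[of k "- s"] uminus_S add_G S_G by blast
    next
      fix x assume "x \<in> G - E"
      then obtain s where "s \<in> S" "x + s \<in> K" using perfect by blast
      then show "x \<in> (\<lambda>(s, k). k - s) ` (S \<times> K)"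
        by (intro image_eqI[of _ _ "(s, x + s)"]) auto
    qed
  qed
  from bij_betw_same_card[OF this] have "N * card K = card (G - E)"
    by (simp add: card_cartesian_product card_S)
  moreover have "N * (2 * card K) = 2 * (N * card K)" by (rule mult.left_commute)
  ultimately have "N * (2 * card K) = N * N" using card_odd by metis
  moreover have "N \<noteq> 0" using N_ge_4 by linarith
  ultimately show ?thesis by (simp only: mult_cancel1 simp_thms)
qed

lemma finite_E: "finite E" and finite_K: "finite K"
  using finite_subset[OF E_G finite_G] finite_subset[OF K_E] by auto

lemma card_E_minus_K: "2 * card (E - K) = N * (N - 1)"
proof -
  have "card (E - K) = card E - card K" by (rule card_Diff_subset[OF finite_K K_E])
  then have "2 * card (E - K) = 2 * card E - 2 * card K" by (simp only: diff_mult_distrib2)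
  also have "\<dots> = N * N - N * 1" by (simp only: card_even two_card_K mult_1_right)
  also have "\<dots> = N * (N - 1)" by (rule diff_mult_distrib2[symmetric])
  finally show ?thesis .
qed

text \<open>Once one representation \<open>x = s + t\<close> is fixed, \<open>sidon\<close> confines
  the first summand of any other to two values: \<open>s\<close> and \<open>t\<close>, or
  \<open>s\<close> and \<open>- s\<close> if \<open>s = t\<close>.\<close>

lemma card_reps_le_2:
  assumes "x \<noteq> 0"
  shows "card {s \<in> S. x - s \<in> S} \<le> 2"
proof (cases "\<exists>s. s \<in> S \<and> x - s \<in> S")
  case True
  then obtain s where s: "s \<in> S" "x - s \<in> S" by blast
  define t where "t = x - s"
  have st: "s \<in> S" "t \<in> S" "x = s + t" using s by (simp_all add: t_def)
  have "s' \<in> (if s = t then {s, - s} else {s, t})" if s': "s' \<in> S" "x - s' \<in> S" for s'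
  proof -
    have "s + t = s' + (x - s')" "s + t \<noteq> 0" using st(3) assms by simp_all
    from sidon[OF st(1,2) s' this] show ?thesis by auto
  qed
  then have "{s \<in> S. x - s \<in> S} \<subseteq> (if s = t then {s, - s} else {s, t})"
    by blast
  moreover have "card (if s = t then {s, - s} else {s, t}) \<le> 2" by (simp add: card_insert_if)
  moreover have "finite (if s = t then {s, - s} else {s, t})" by simp
  ultimately show ?thesis by (meson card_mono le_trans)
next
  case False
  then have "{s \<in> S. x - s \<in> S} = {}" by blast
  then show ?thesis by (simp only: card.empty)
qed

text \<open>Double counting: the \<open>N (N - 1)\<close> pairs with sum outside \<open>K\<close> are spread over
  \<open>N (N - 1) / 2\<close> sums, each of which has at most two representations.\<close>

lemma card_reps_eq_2:
  assumes "x \<in> E - K"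
  shows "card {s \<in> S. x - s \<in> S} = 2"
proof -
  let ?r = "\<lambda>x. card {s \<in> S. x - s \<in> S}"
  let ?P = "{(s, t). s \<in> S \<and> t \<in> S \<and> t \<noteq> - s}"
  have P: "?P = (SIGMA s:S. S - {- s})" by auto
  have card_P: "card ?P = N * (N - 1)"
    unfolding P using finite_S by (simp add: card_SigmaI card_Diff_singleton_if uminus_S card_S)
  have "bij_betw (\<lambda>(s, t). (s + t, s)) ?P (SIGMA x:E - K. {s \<in> S. x - s \<in> S})"
  proof (rule bij_betw_byWitness[where f' = "\<lambda>(x, s). (s, x - s)"])
    show "(\<lambda>(s, t). (s + t, s)) ` ?P \<subseteq> (SIGMA x:E - K. {s \<in> S. x - s \<in> S})"
    proof (rule image_subsetI)
      fix p assume "p \<in> ?P"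
      then obtain s t where p: "p = (s, t)" and st: "s \<in> S" "t \<in> S" "t \<noteq> - s" by blast
      have "s + t \<in> E" using parity[of s t] S_G S_E st(1,2) by simp
      moreover have "s + t \<notin> K" using add_S_in_K[OF st(1,2)] st(3) by blast
      ultimately show "(case p of (s, t) \<Rightarrow> (s + t, s)) \<in> (SIGMA x:E - K. {s \<in> S. x - s \<in> S})"
        using st p by simp
    qed
    show "(\<lambda>(x, s). (s, x - s)) ` (SIGMA x:E - K. {s \<in> S. x - s \<in> S}) \<subseteq> ?P"
      using zero_K by auto
  qed auto
  from bij_betw_same_card[OF this]
  have "card (SIGMA x:E - K. {s \<in> S. x - s \<in> S}) = N * (N - 1)" using card_P by simp
  moreover have "card (SIGMA x:E - K. {s \<in> S. x - s \<in> S}) = (\<Sum>x\<in>E - K. ?r x)"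
    using finite_E finite_S by (intro card_SigmaI) auto
  ultimately have sum: "(\<Sum>x\<in>E - K. ?r x) = N * (N - 1)" by simp
  have le: "?r x \<le> 2" if "x \<in> E - K" for x
    by (rule card_reps_le_2) (use that zero_K in auto)
  show ?thesis
  proof (rule ccontr)
    assume "?r x \<noteq> 2"
    then have "?r x < 2" using le[OF assms] by simp
    then have "(\<Sum>x\<in>E - K. ?r x) < (\<Sum>x\<in>E - K. 2)"
      using assms le finite_E by (intro sum_strict_mono_ex1) auto
    also have "(\<Sum>x\<in>E - K. 2) = 2 * card (E - K)" by simp
    finally show False by (simp only: sum card_E_minus_K)
  qed
qed

section \<open>Levels, their sizes and the neighbour counts between them\<close>

definition level :: "'g \<Rightarrow> nat" where
  "level x = (if x = 0 then 0 else if x \<in> S then 1 else if x \<notin> E then 3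
     else if x \<in> K then 4 else 2)"

text \<open>The tests in \<open>level\<close> overlap, as 0 lies in \<open>K\<close> and
  \<open>S\<close> in the complement of \<open>E\<close>; their order makes the five levels the
  disjoint classes that turn out to be the spheres around 0.\<close>

lemma level_eq:
  "level x = 0 \<longleftrightarrow> x = 0"
  "level x = Suc 0 \<longleftrightarrow> x \<in> S"
  "level x = 2 \<longleftrightarrow> x \<in> E - K"
  "level x = 3 \<longleftrightarrow> x \<notin> E \<and> x \<notin> S"
  "level x = 4 \<longleftrightarrow> x \<in> K \<and> x \<noteq> 0"
  using zero_K zero_E S_E S_K K_E by (auto simp: level_def)

lemma level_le_4: "level x \<le> 4"
  by (simp add: level_def)

lemma odd_level: "odd (level x) \<longleftrightarrow> x \<notin> E"
  using zero_E S_E by (auto simp: level_def)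

lemma nbrs:
  assumes "x \<in> G"
  shows "level x = 0 \<Longrightarrow> {s \<in> S. level (x + s) = 1} = S"
    and "level x = 1 \<Longrightarrow> {s \<in> S. level (x + s) = 0} = {- x}"
    and "level x = 1 \<Longrightarrow> {s \<in> S. level (x + s) = 2} = S - {- x}"
    and "level x = 2 \<Longrightarrow> card {s \<in> S. level (x + s) = 1} = 2"
    and "level x = 2 \<Longrightarrow> {s \<in> S. level (x + s) = 3} = S - {s \<in> S. level (x + s) = 1}"
    and "level x = 3 \<Longrightarrow> card {s \<in> S. level (x + s) = 4} = 1"
    and "level x = 3 \<Longrightarrow> {s \<in> S. level (x + s) = 2} = S - {s \<in> S. level (x + s) = 4}"
    and "level x = 4 \<Longrightarrow> {s \<in> S. level (x + s) = 3} = S"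
proof -
  show "level x = 0 \<Longrightarrow> {s \<in> S. level (x + s) = 1} = S"
    by (auto simp: level_eq)
  show "level x = 1 \<Longrightarrow> {s \<in> S. level (x + s) = 0} = {- x}"
    using uminus_S_iff[of x] by (auto simp: level_eq add_eq_0_iff)
  show "level x = 1 \<Longrightarrow> {s \<in> S. level (x + s) = 2} = S - {- x}"
  proof -
    assume "level x = 1"
    then have x: "x \<in> S" by (simp add: level_eq)
    have "x + s \<in> E" if "s \<in> S" for s using parity[OF assms that] S_E[OF x] by blast
    moreover have "x + s \<in> K \<longleftrightarrow> s = - x" if "s \<in> S" for s
      using add_S_in_K[OF x that] zero_K by auto
    ultimately show ?thesis by (auto simp: level_eq)
  qed
  \<comment> \<open>Negation turns a neighbour \<open>x + s\<close> in \<open>S\<close> into a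
    representation \<open>x = (x + s) + (- s)\<close>, so the count of representations
    applies.\<close>
  have "bij_betw uminus {s \<in> S. x + s \<in> S} {s \<in> S. x - s \<in> S}"
    by (rule bij_betw_byWitness[where f' = uminus]) (auto simp: uminus_S)
  then have "card {s \<in> S. x + s \<in> S} = card {s \<in> S. x - s \<in> S}"
    by (rule bij_betw_same_card)
  then show "level x = 2 \<Longrightarrow> card {s \<in> S. level (x + s) = 1} = 2"
    using card_reps_eq_2 by (simp add: level_eq)
  show "level x = 2 \<Longrightarrow> {s \<in> S. level (x + s) = 3} = S - {s \<in> S. level (x + s) = 1}"
    using parity[OF assms] by (auto simp: level_eq)
  show "level x = 3 \<Longrightarrow> card {s \<in> S. level (x + s) = 4} = 1"
  proof -
    assume *: "level x = 3"
    then obtain s where s: "s \<in> S" "x + s \<in> K" and s_eq: "\<And>t. t \<in> S \<Longrightarrow> x + t \<in> K \<Longrightarrow> t = s"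
      using perfect[of x] assms by (auto simp: level_eq)
    have "x + s \<noteq> 0" using * s uminus_S_iff[of x] by (auto simp: level_eq add_eq_0_iff)
    then have eq: "{s \<in> S. level (x + s) = 4} = {s}"
      using s s_eq unfolding level_eq by blast
    show ?thesis unfolding eq by simp
  qed
  show "level x = 3 \<Longrightarrow> {s \<in> S. level (x + s) = 2} = S - {s \<in> S. level (x + s) = 4}"
  proof -
    assume "level x = 3"
    then have x: "x \<notin> E" "x \<notin> S" by (simp_all add: level_eq)
    have "x + s \<in> E" "x + s \<noteq> 0" if "s \<in> S" for s
      using parity[OF assms that] uminus_S_iff[of x] x that by (auto simp: add_eq_0_iff)
    then show ?thesis by (auto simp: level_eq)
  qed
  show "level x = 4 \<Longrightarrow> {s \<in> S. level (x + s) = 3} = S"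
  proof -
    assume "level x = 4"
    then have x: "x \<in> K" "x \<noteq> 0" by (simp_all add: level_eq)
    have "x + s \<notin> E \<and> x + s \<notin> S" if "s \<in> S" for s
      using parity[OF assms that] K_plus_S_not_S[OF x that] K_E x(1) by blast
    then show ?thesis by (auto simp: level_eq)
  qed
qed

lemma level_same:
  assumes "x \<in> G"
  shows "{s \<in> S. level (x + s) = level x} = {}"
proof -
  have "level (x + s) \<noteq> level x" if "s \<in> S" for s
    using odd_level[of x] odd_level[of "x + s"] parity[OF assms that] by auto
  then show ?thesis by blast
qed

lemma card_nbrs:
  assumes "x \<in> G"
  shows "level x = 0 \<Longrightarrow> card {s \<in> S. level (x + s) = 1} = N"
    and "level x = 1 \<Longrightarrow> card {s \<in> S. level (x + s) = 0} = 1"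
    and "level x = 1 \<Longrightarrow> card {s \<in> S. level (x + s) = 2} = N - 1"
    and "level x = 2 \<Longrightarrow> card {s \<in> S. level (x + s) = 1} = 2"
    and "level x = 2 \<Longrightarrow> card {s \<in> S. level (x + s) = 3} = N - 2"
    and "level x = 3 \<Longrightarrow> card {s \<in> S. level (x + s) = 2} = N - 1"
    and "level x = 3 \<Longrightarrow> card {s \<in> S. level (x + s) = 4} = 1"
    and "level x = 4 \<Longrightarrow> card {s \<in> S. level (x + s) = 3} = N"
    and "card {s \<in> S. level (x + s) = level x} = 0"
proof -
  show "level x = 1 \<Longrightarrow> card {s \<in> S. level (x + s) = 2} = N - 1"
    using nbrs(3)[OF assms] by (simp add: level_eq card_Diff_singleton_if uminus_S card_S)
  show "level x = 2 \<Longrightarrow> card {s \<in> S. level (x + s) = 3} = N - 2"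
    using nbrs(4,5)[OF assms] finite_S by (simp add: card_Diff_subset card_S)
  show "level x = 3 \<Longrightarrow> card {s \<in> S. level (x + s) = 2} = N - 1"
    using nbrs(6,7)[OF assms] finite_S by (simp add: card_Diff_subset card_S)
  show "card {s \<in> S. level (x + s) = level x} = 0"
    by (simp only: level_same[OF assms] card.empty)
qed (use nbrs[OF assms] in \<open>simp_all add: card_S\<close>)

lemma level_pred:
  assumes "x \<in> G" "level x = Suc j"
  shows "\<exists>s\<in>S. level (x + s) = j"
proof -
  have "j = 0 \<or> j = 1 \<or> j = 2 \<or> j = 3" using assms(2) level_le_4[of x] by linarith
  then have "card {s \<in> S. level (x + s) = j} > 0"
    using card_nbrs[OF assms(1)] assms(2) N_ge_4 by (auto simp: eval_nat_numeral)
  then show ?thesis by (metis (mono_tags, lifting) card.empty empty_Collect_eq less_irrefl)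
qed

text \<open>Each edge changes parity, which leaves only the jumps from 0 to 3 and from 1 to 4 to be
  excluded: the neighbours of 0 are \<open>S\<close>, and \<open>add_S_in_K\<close> keeps
  \<open>K - {0}\<close> away from \<open>S\<close>.\<close>

lemma level_step:
  assumes "x \<in> G" "s \<in> S"
  shows "level (x + s) \<le> Suc (level x)"
proof -
  have *: "level (x + s) = 0 \<Longrightarrow> x \<in> S" "x = 0 \<Longrightarrow> level (x + s) = 1"
     using assms uminus_S_iff[of x] by (auto simp: level_eq add_eq_0_iff)
  have "odd (level (x + s)) \<noteq> odd (level x)" using parity assms odd_level by blast
  moreover have "level x = 1 \<Longrightarrow> level (x + s) \<noteq> 4"
    using assms add_S_in_K[of x s] by (auto simp: level_eq)
  moreover have "level x = 0 \<Longrightarrow> level (x + s) = 1" using * by (auto simp: level_eq)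
  moreover have "level x \<in> {0, 1, 2, 3, 4}" "level (x + s) \<in> {0, 1, 2, 3, 4}"
    by (simp_all add: level_def)
  ultimately show ?thesis by auto
qed

lemma card_level:
  "card {x \<in> G. level x = 0} = 1"
  "card {x \<in> G. level x = 1} = N"
  "card {x \<in> G. level x = 2} = N choose 2"
  "card {x \<in> G. level x = 3} = N * (N - 2) div 2"
  "card {x \<in> G. level x = 4} = (N - 2) div 2"
proof -
  have "{x \<in> G. level x = 0} = {0}" using zero_G by (auto simp: level_eq)
  then show "card {x \<in> G. level x = 0} = 1" by simp
  have "{x \<in> G. level x = 1} = S" using S_G by (auto simp: level_eq)
  then show "card {x \<in> G. level x = 1} = N" using card_S by simp
  have "{x \<in> G. level x = 2} = E - K" using E_G by (auto simp: level_eq)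
  then show "card {x \<in> G. level x = 2} = N choose 2" 
    using card_E_minus_K by (simp add: choose_two)
  have "{x \<in> G. level x = 3} = (G - E) - S" by (auto simp: level_eq)
  then have "card {x \<in> G. level x = 3} = card (G - E) - N"
    using S_odd finite_S card_S by (simp add: card_Diff_subset)
  then have "2 * card {x \<in> G. level x = 3} = 2 * card (G - E) - 2 * N"
    by (simp only: diff_mult_distrib2)
  also have "\<dots> = N * (N - 2)"
    by (simp only: card_odd diff_mult_distrib2 mult.commute)
  finally have "2 * card {x \<in> G. level x = 3} = N * (N - 2)" .
  then show "card {x \<in> G. level x = 3} = N * (N - 2) div 2" by simp
  have "{x \<in> G. level x = 4} = K - {0}" using E_G K_E by (auto simp: level_eq)
  then have "2 * card {x \<in> G. level x = 4} = N - 2"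
    using two_card_K zero_K by (simp add: diff_mult_distrib2)
  then show "card {x \<in> G. level x = 4} = (N - 2) div 2" by simp
qed

end

section \<open>Transfer from the group to a graph\<close>

locale antipodal_cayley_graph = antipodal_cayley G E K S N
  for G E K S :: "'g::ab_group_add set" and N +
  fixes V :: "'v set" and adj :: "'v \<Rightarrow> 'v \<Rightarrow> bool" and v :: "'g \<Rightarrow> 'v"
  assumes v: "bij_betw v G V"
    and adj_V: "\<And>u w. adj u w \<Longrightarrow> u \<in> V \<and> w \<in> V"
    and adj_v: "\<And>x y. x \<in> G \<Longrightarrow> y \<in> G \<Longrightarrow> adj (v x) (v y) \<longleftrightarrow> x - y \<in> S"
begin

lemma v_V: "x \<in> G \<Longrightarrow> v x \<in> V"
  using v by (rule bij_betwE[THEN bspec])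

lemma V_cases:
  assumes "u \<in> V" obtains x where "x \<in> G" "u = v x"
  using v assms by (metis bij_betw_imp_surj_on imageE)

lemma v_eq: "x \<in> G \<Longrightarrow> y \<in> G \<Longrightarrow> v x = v y \<longleftrightarrow> x = y"
  using v by (metis bij_betw_imp_inj_on inj_on_eq_iff)

lemma adj_shift: "x \<in> G \<Longrightarrow> s \<in> S \<Longrightarrow> adj (v x) (v (x + s)) \<and> adj (v (x + s)) (v x)"
  using adj_v add_G S_G uminus_S by simp

text \<open>Translation by \<open>x\<close> reduces to distances from 0, where
  \<open>level_step\<close> and \<open>level_pred\<close> show that \<open>level\<close> meets the
  criterion \<open>at_dist_iff_level\<close>. The function \<open>lev\<close> carries it to vertices
  through the inverse of \<open>v\<close>.\<close>

lemma at_dist_v: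
  assumes "x \<in> G" "y \<in> G"
  shows "at_dist adj j (v x) (v y) \<longleftrightarrow> level (y - x) = j"
proof -
  define lev where "lev w = level (inv_into G v w - x)" for w
  have lev: "lev (v z) = level (z - x)" if "z \<in> G" for z
    using that v by (simp add: lev_def bij_betw_def)
  have "at_dist adj j (v x) (v y) \<longleftrightarrow> lev (v y) = j"
  proof (rule at_dist_iff_level[where V = V])
    show "lev w = 0 \<longleftrightarrow> w = v x" if "w \<in> V" for w
      using that assms(1) by (elim V_cases) (auto simp: lev level_eq v_eq)
    show "lev z \<le> Suc (lev w)" if wz: "adj w z" for w z
    proof -
      obtain a b where ab: "a \<in> G" "w = v a" "b \<in> G" "z = v b"
        using adj_V[OF wz] by (metis V_cases)
      then have "- (a - b) \<in> S" using wz adj_v uminus_S by blast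
      from level_step[OF diff_G[OF ab(1) assms(1)] this] show ?thesis
        using ab by (simp add: lev)
    qed
    show "\<exists>z. adj z w \<and> lev z = i" if w: "w \<in> V" "lev w = Suc i" for w i
    proof -
      obtain a where a: "a \<in> G" "w = v a" using w by (metis V_cases)
      then obtain s where s: "s \<in> S" "level (a - x + s) = i"
        using level_pred[of "a - x"] w(2) diff_G assms(1) lev by metis
      then have "lev (v (a + s)) = i" using a add_G S_G by (simp add: lev algebra_simps)
      then show ?thesis using adj_shift[OF a(1) s(1)] a(2) by blast
    qed
  qed (use adj_V v_V assms in auto)
  then show ?thesis using lev assms by simp
qed

text \<open>The neighbours of \<open>v y\<close> are the vertices \<open>v (y + s)\<close> with
  \<open>s\<close> in \<open>S\<close>, without repetition, so counts depend on the difference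
  \<open>y - x\<close> only.\<close>

lemma card_nbrs_v:
  assumes "x \<in> G" "y \<in> G"
  shows "card {z \<in> V. adj (v y) z \<and> at_dist adj i (v x) z}
    = card {s \<in> S. level (y - x + s) = i}"
proof -
  have "bij_betw (\<lambda>s. v (y + s)) {s \<in> S. level (y - x + s) = i}
    {z \<in> V. adj (v y) z \<and> at_dist adj i (v x) z}"
    unfolding bij_betw_def
  proof
    show "inj_on (\<lambda>s. v (y + s)) {s \<in> S. level (y - x + s) = i}"
    proof (rule inj_onI)
      fix s t
      assume "s \<in> {s \<in> S. level (y - x + s) = i}" "t \<in> {s \<in> S. level (y - x + s) = i}"
        and eq: "v (y + s) = v (y + t)"
      then have "y + s \<in> G" "y + t \<in> G" using assms add_G S_G by auto
      then show "s = t" using eq v_eq by simp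
    qed
    show "(\<lambda>s. v (y + s)) ` {s \<in> S. level (y - x + s) = i}
      = {z \<in> V. adj (v y) z \<and> at_dist adj i (v x) z}"
    proof (intro equalityI subsetI)
      fix z assume "z \<in> (\<lambda>s. v (y + s)) ` {s \<in> S. level (y - x + s) = i}"
      then obtain s where s: "s \<in> S" "level (y - x + s) = i" "z = v (y + s)" by blast
      then have "y + s \<in> G" using assms add_G S_G by blast
      moreover from this have "at_dist adj i (v x) z"
        using assms s by (simp add: at_dist_v diff_add_eq)
      ultimately show "z \<in> {z \<in> V. adj (v y) z \<and> at_dist adj i (v x) z}"
        using adj_shift[OF assms(2) s(1)] v_V s(3) by blast
    next
      fix z assume z: "z \<in> {z \<in> V. adj (v y) z \<and> at_dist adj i (v x) z}"
      then obtain a where a: "a \<in> G" "z = v a" by (metis V_cases mem_Collect_eq)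
      then have "y - a \<in> S" "level (a - x) = i" using z assms by (auto simp: adj_v at_dist_v)
      moreover from this have "a - y \<in> S" using uminus_S by force
      ultimately show "z \<in> (\<lambda>s. v (y + s)) ` {s \<in> S. level (y - x + s) = i}"
        using a by (intro image_eqI[of _ _ "a - y"]) auto
    qed
  qed
  then show ?thesis by (simp add: bij_betw_same_card)
qed

lemma valency:
  assumes "card {x \<in> G. level x = j} = k"
  shows "has_valency V adj j k"
  unfolding has_valency_def
proof
  fix u assume "u \<in> V"
  then obtain x where x: "x \<in> G" "u = v x" by (rule V_cases)
  have "bij_betw (\<lambda>y. v (x + y)) {y \<in> G. level y = j} {w \<in> V. at_dist adj j u w}"
    unfolding bij_betw_def
  proof
    show "inj_on (\<lambda>y. v (x + y)) {y \<in> G. level y = j}"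
    proof (rule inj_onI)
      fix y z
      assume "y \<in> {y \<in> G. level y = j}" "z \<in> {y \<in> G. level y = j}"
        and eq: "v (x + y) = v (x + z)"
      then have "x + y \<in> G" "x + z \<in> G" using x add_G by auto
      then show "y = z" using eq v_eq by simp
    qed
    show "(\<lambda>y. v (x + y)) ` {y \<in> G. level y = j} = {w \<in> V. at_dist adj j u w}"
    proof (intro equalityI subsetI)
      fix w assume "w \<in> (\<lambda>y. v (x + y)) ` {y \<in> G. level y = j}"
      then show "w \<in> {w \<in> V. at_dist adj j u w}"
        using x add_G v_V by (auto simp: at_dist_v)
    next
      fix w assume w: "w \<in> {w \<in> V. at_dist adj j u w}"
      then obtain a where "a \<in> G" "w = v a" by (metis V_cases mem_Collect_eq)
      then show "w \<in> (\<lambda>y. v (x + y)) ` {y \<in> G. level y = j}"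
        using w x diff_G by (intro image_eqI[of _ _ "a - x"]) (auto simp: at_dist_v)
    qed
  qed
  then show "card {w \<in> V. at_dist adj j u w} = k"
    using assms by (simp add: bij_betw_same_card)
qed

lemma nbrs_has:
  assumes "\<And>x. x \<in> G \<Longrightarrow> level x = j \<Longrightarrow> card {s \<in> S. level (x + s) = i} = k"
  shows "\<forall>u\<in>V. \<forall>w\<in>V. at_dist adj j u w
    \<longrightarrow> card {z \<in> V. adj w z \<and> at_dist adj i u z} = k"
  using assms by (auto elim!: V_cases simp: at_dist_v card_nbrs_v diff_G)

lemma has_cI:
  assumes "j = i + 1"
    and "\<And>x. x \<in> G \<Longrightarrow> level x = j \<Longrightarrow> card {s \<in> S. level (x + s) = i} = k"
  shows "has_c V adj j k"
  using nbrs_has[OF assms(2)] assms(1) by (simp add: has_c_def)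

lemma has_bI:
  assumes "i = j + 1"
    and "\<And>x. x \<in> G \<Longrightarrow> level x = j \<Longrightarrow> card {s \<in> S. level (x + s) = i} = k"
  shows "has_b V adj j k"
  using nbrs_has[OF assms(2)] assms(1) by (simp add: has_b_def)

lemma diameter: "has_diameter V adj 4"
proof -
  have "(N - 2) div 2 \<noteq> 0" using N_ge_4 by simp
  then obtain x where "x \<in> G" "level x = 4"
    using card_level(5) by (metis (mono_tags, lifting) card.empty empty_Collect_eq)
  then have "v 0 \<in> V" "v x \<in> V" "at_dist adj 4 (v 0) (v x)"
    using zero_G v_V by (auto simp: at_dist_v)
  moreover have "\<exists>j\<le>4. at_dist adj j u w" if "u \<in> V" "w \<in> V" for u w
    using that level_le_4 by (auto elim!: V_cases simp: at_dist_v)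
  ultimately show ?thesis unfolding has_diameter_def by blast
qed

lemma parameters:
  "has_diameter V adj 4
    \<and> has_valency V adj 0 1
    \<and> has_valency V adj 1 N
    \<and> has_valency V adj 2 (N choose 2)
    \<and> has_valency V adj 3 (N * (N - 2) div 2)
    \<and> has_valency V adj 4 ((N - 2) div 2)
    \<and> has_b V adj 0 N
    \<and> has_c V adj 1 1 \<and> has_b V adj 1 (N - 1)
    \<and> has_c V adj 2 2 \<and> has_b V adj 2 (N - 2)
    \<and> has_c V adj 3 (N - 1) \<and> has_b V adj 3 1
    \<and> has_c V adj 4 N
    \<and> (\<forall>j\<le>4. has_a V adj j 0)"
proof (intro conjI allI impI)
  show "has_c V adj 1 1" using card_nbrs(2) by (intro has_cI[of _ _ "1"]) simp_all
  show "has_c V adj 2 2" using card_nbrs(4) by (intro has_cI[of _ _ "2"]) simp_all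
  show "has_c V adj 3 (N - 1)" using card_nbrs(6) by (intro has_cI[of _ _ "N - 1"]) simp_all
  show "has_c V adj 4 N" using card_nbrs(8) by (intro has_cI[of _ _ "N"]) simp_all
  show "has_b V adj 0 N" using card_nbrs(1) by (intro has_bI[of _ _ "N"]) simp_all
  show "has_b V adj 1 (N - 1)" using card_nbrs(3) by (intro has_bI[of 2 _ "N - 1"]) simp_all
  show "has_b V adj 2 (N - 2)" using card_nbrs(5) by (intro has_bI[of _ _ "N - 2"]) simp_all
  show "has_b V adj 3 1" using card_nbrs(7) by (intro has_bI[of _ _ "1"]) simp_all
  show "has_a V adj j 0" for j
    unfolding has_a_def by (rule nbrs_has) (metis card_nbrs(9))
qed (use diameter valency card_level in blast)+

end

subsection \<open>Polynomials over the integers modulo 4\<close>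

lemma Z4_cases: "x = 0 \<or> x = 1 \<or> x = 2 \<or> x = 3" for x :: 4
proof (induct x)
  case (of_int z)
  then have "0 \<le> z" and "z < 4" by simp_all
  then have "z = 0 \<or> z = 1 \<or> z = 2 \<or> z = 3" by arith
  then show ?case by auto
qed

lemma UNIV_bit: "(UNIV :: bit set) = {0, 1}"
  by (auto intro: bit.exhaust)

lemma finite_bit: "finite (UNIV :: bit set)" and card_bit: "CARD(bit) = 2"
  by (simp_all add: UNIV_bit)

lemma red2_0 [simp]: "red2 0 = 0" and red2_1 [simp]: "red2 1 = 1"
  by (simp_all add: red2_def)

lemma red2_add: "red2 (a + b) = red2 a + red2 b"
  using Z4_cases[of a] Z4_cases[of b] by (auto simp: red2_def)

lemma red2_mult: "red2 (a * b) = red2 a * red2 b"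
  using Z4_cases[of a] Z4_cases[of b] by (auto simp: red2_def)

lemma red2_eq_0_iff: "red2 a = 0 \<longleftrightarrow> a + a = 0"
  using Z4_cases[of a] by (auto simp: red2_def)

lemma red2_eq_0_half: "red2 a = 0 \<Longrightarrow> \<exists>b. a = b + b"
  using Z4_cases[of a] by (auto simp: red2_def intro: exI[of _ 0] exI[of _ 1])

abbreviation red :: "4 poly \<Rightarrow> bit poly" where
  "red \<equiv> map_poly red2"

lemma coeff_red: "coeff (red f) k = red2 (coeff f k)"
  by (simp add: coeff_map_poly)

lemma red_add: "red (f + g) = red f + red g"
  by (rule poly_eqI) (simp add: coeff_red red2_add)

lemma red_diff: "red (f - g) = red f - red g"
  using red_add[of "f - g" g] by simp

lemma red2_sum: "red2 (\<Sum>i\<in>A. u i) = (\<Sum>i\<in>A. red2 (u i))"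
  by (induction A rule: infinite_finite_induct) (simp_all add: red2_add)

lemma red_mult: "red (f * g) = red f * red g"
  by (rule poly_eqI) (simp add: coeff_red coeff_mult red2_sum red2_mult)

lemma red_monom: "red (monom a k) = monom (red2 a) k"
  by (simp add: map_poly_monom)

lemma red_eq_0_iff: "red f = 0 \<longleftrightarrow> f + f = 0"
  by (simp only: poly_eq_iff coeff_red red2_eq_0_iff coeff_add coeff_0)

lemma red_eq_0_half:
  assumes "red f = 0"
  obtains g where "f = g + g"
proof -
  \<comment> \<open>The second clause pins the choice at 0, which is also 2 + 2;
    \<open>map_poly\<close> needs a function fixing 0 for its coefficients to be as
    expected.\<close>
  have "\<exists>b. a = b + b \<and> (a = 0 \<longrightarrow> b = 0)" if "red2 a = 0" for a
    using red2_eq_0_half[OF that] by (cases "a = 0") auto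
  then obtain half where half: "\<And>a. red2 a = 0 \<Longrightarrow> a = half a + half a \<and> (a = 0 \<longrightarrow> half a = 0)"
    by metis
  then have "half 0 = 0" using half[of 0] red2_0 by blast
  moreover have "red2 (coeff f k) = 0" for k using assms coeff_red by (metis coeff_0)
  ultimately have "f = map_poly half f + map_poly half f"
    using half by (intro poly_eqI) (simp only: coeff_map_poly coeff_add)
  then show ?thesis by (rule that)
qed

lemma red_surj: "\<exists>f. red f = p"
proof
  have "red2 (if b = 1 then 1 else 0) = b" for b by (cases b) (auto simp: red2_def)
  then show "red (map_poly (\<lambda>b. if b = 1 then 1 else 0) p) = p"
    by (intro poly_eqI) (simp add: coeff_red coeff_map_poly)
qed

lemma four_eq_0: "(4 :: 4 poly) = 0"
proof -
  have "(4 :: 4) = 0" by simp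
  then show ?thesis by (simp only: numeral_poly pCons_0_0)
qed

lemma red_double: "red (f + f) = 0"
proof -
  have "f + f + (f + f) = 4 * f" by simp
  then show ?thesis by (simp only: red_eq_0_iff four_eq_0 mult_zero_left)
qed

text \<open>Long division by a monic polynomial needs no inverses: subtracting a monomial multiple
  of \<open>h\<close> removes the top coefficient, and \<open>k\<close> bounds the number of such
  steps.\<close>

lemma monic_rem_exists:
  fixes h :: "'a::comm_ring_1 poly"
  assumes "lead_coeff h = 1" "degree h > 0"
  shows "\<exists>r. degree r < degree h \<and> h dvd f - r"
proof -
  have "\<exists>r. degree r < degree h \<and> h dvd f - r" if "degree f < degree h + k" for k f
    using that
  proof (induction k arbitrary: f)
    case 0
    then show ?case by (intro exI[of _ f]) simp
  next
    case (Suc k)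
    define g where "g = f - monom (coeff f (degree h + k)) k * h"
    have "coeff g i = 0" if "i \<ge> degree h + k" for i
    proof (cases "i = degree h + k")
      case True
      then show ?thesis using assms(1) by (simp add: g_def coeff_monom_mult)
    next
      case False
      then have "i > degree h + k" using that by simp
      then have "coeff f i = 0" "coeff h (i - k) = 0"
        using Suc.prems by (auto intro!: coeff_eq_0)
      then show ?thesis by (simp add: g_def coeff_monom_mult)
    qed
    then have "degree g < degree h + k" using assms(2) by (intro degree_lessI) auto
    then obtain r where r: "degree r < degree h" "h dvd g - r" using Suc.IH by blast
    have "f - r = (g - r) + monom (coeff f (degree h + k)) k * h" by (simp add: g_def)
    also have "h dvd \<dots>" using r(2) by (intro dvd_add dvd_triv_right)
    finally have "h dvd f - r" .
    then show ?case using r(1) by blast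
  qed
  from this[of f "Suc (degree f)"] show ?thesis by simp
qed

lemma monic_dvd_degree_less:
  fixes h :: "'a::comm_ring_1 poly"
  assumes "lead_coeff h = 1" "h dvd r" "degree r < degree h"
  shows "r = 0"
proof (rule ccontr)
  assume "r \<noteq> 0"
  obtain q where q: "r = h * q" using assms(2) by blast
  have "coeff r (degree h + degree q) = lead_coeff q"
    using assms(1) by (simp add: q coeff_mult_degree_sum)
  also have "\<dots> \<noteq> 0" using \<open>r \<noteq> 0\<close> q by auto
  finally have "degree h + degree q \<le> degree r" by (rule le_degree)
  then show False using assms(3) by simp
qed

lemma card_degree_less:
  assumes "m > 0" "finite (UNIV :: 'a::comm_ring_1 set)"
  shows "card {p :: 'a poly. degree p < m} = CARD('a) ^ m"
    and "finite {p :: 'a poly. degree p < m}"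
proof -
  \<comment> \<open>Bounding coefficients instead of the degree makes sense for m = 0 too, where
    only the zero polynomial is left; the induction starts there.\<close>
  define D where "D m = {p :: 'a poly. \<forall>i\<ge>m. coeff p i = 0}" for m
  have "finite (D m) \<and> card (D m) = CARD('a) ^ m" for m
  proof (induction m)
    case 0
    have "D 0 = {0}" by (auto simp: D_def poly_eq_iff)
    then show ?case by simp
  next
    case (Suc m)
    have "D (Suc m) = case_prod pCons ` (UNIV \<times> D m)"
    proof (intro equalityI subsetI)
      fix p assume p: "p \<in> D (Suc m)"
      obtain a q where "p = pCons a q" by (cases p)
      moreover from this p have "q \<in> D m" by (fastforce simp: D_def coeff_pCons)
      ultimately show "p \<in> case_prod pCons ` (UNIV \<times> D m)" by auto
    next
      fix p assume "p \<in> case_prod pCons ` (UNIV \<times> D m)"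
      then show "p \<in> D (Suc m)" by (auto simp: D_def coeff_pCons split: nat.split)
    qed
    moreover have "inj_on (case_prod pCons) (UNIV \<times> D m)" by (auto intro!: inj_onI)
    ultimately show ?case using Suc assms(2) by (simp add: card_image card_cartesian_product)
  qed
  moreover have "{p :: 'a poly. degree p < m} = D m"
    using assms(1) by (auto simp: D_def intro: coeff_eq_0 degree_lessI)
  ultimately show "card {p :: 'a poly. degree p < m} = CARD('a) ^ m"
    and "finite {p :: 'a poly. degree p < m}" by simp_all
qed

section \<open>Standing data of the code\<close>

locale teichmueller =
  fixes m n :: nat and h :: "4 poly"
  assumes odd_m: "odd m"
    and n_def: "n = 2 ^ m - 1"
    and primitive: "primitive_irreducible (red h)"
    and monic: "lead_coeff h = 1" and degree_h: "degree h = m"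
    and h_dvd: "h dvd monom 1 n - 1"
begin

lemma m_pos: "m > 0"
  using odd_m by (cases m) auto

lemma Suc_n: "Suc n = 2 ^ m"
  by (simp add: n_def)

lemma n_pos: "n > 0" and odd_n: "odd n"
proof -
  have "even (Suc n)" using m_pos by (simp add: Suc_n)
  then show "odd n" by simp
  then show "n > 0" by (rule odd_pos)
qed

text \<open>For odd \<open>m\<close> the power 2^m = 2 * 4^k is 2 modulo 3, so n is 1 modulo 3. The
  proof of \<open>in_max_cube\<close> uses this to cancel the exponent 3.\<close>

lemma coprime_3_n: "coprime 3 n"
proof -
  obtain k where "m = 2 * k + 1" using odd_m by (rule oddE)
  then have "(2::nat) ^ m = 2 * 4 ^ k" by (simp add: power_mult)
  moreover have "(4::nat) ^ k mod 3 = 1" by (induction k) (simp_all add: mod_mult_right_eq[symmetric])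
  ultimately have "Suc n mod 3 = 2" using Suc_n by (simp add: mod_mult_right_eq[symmetric])
  then have "n mod 3 = 1" by presburger
  then have "\<not> 3 dvd n" by presburger
  moreover have "prime (3::nat)" by simp
  ultimately show ?thesis by (rule prime_imp_coprime[rotated])
qed

subsection \<open>The residue field\<close>

text \<open>This is the maximal ideal (2, h) of Z_4[X], tested after reduction modulo 2; its
  quotient is the residue field GF(2^m) of R.\<close>

definition in_max :: "4 poly \<Rightarrow> bool" where
  "in_max f \<longleftrightarrow> red h dvd red f"

lemma prime_h2: "prime_elem (red h)"
  using primitive field_poly_irreducible_imp_prime by (auto simp: primitive_irreducible_def)

lemma degree_h2: "degree (red h) = m"
proof -
  have "degree (red h) \<le> m" using degree_h by (auto intro!: degree_le simp: coeff_red coeff_eq_0)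
  moreover have "coeff (red h) m = 1" using monic degree_h by (simp add: coeff_red)
  then have "m \<le> degree (red h)" by (intro le_degree) simp
  ultimately show ?thesis by simp
qed

lemma in_max_add: "in_max f \<Longrightarrow> in_max g \<Longrightarrow> in_max (f + g)"
  and in_max_diff: "in_max f \<Longrightarrow> in_max g \<Longrightarrow> in_max (f - g)"
  and in_max_mult: "in_max f \<Longrightarrow> in_max (f * g)"
  by (simp_all add: in_max_def red_add red_diff red_mult)

lemma in_max_double: "in_max (f + f)"
  by (simp only: in_max_def red_double dvd_0_right)

lemma in_max_prime: "in_max (f * g) \<Longrightarrow> in_max f \<or> in_max g"
  unfolding in_max_def red_mult using prime_elem_dvd_multD[OF prime_h2] .

lemma dvd_in_max: "h dvd f \<Longrightarrow> in_max f"
  by (auto simp: in_max_def red_mult)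

lemma in_max_cong:
  assumes "in_max (f - g)"
  shows "in_max f \<longleftrightarrow> in_max g"
  using in_max_add[OF assms, of g] in_max_diff[of f, OF _ assms] by auto

text \<open>A quotient modulo 2 is lifted to Z_4; what remains then reduces to 0 and so is twice a
  polynomial. This gives explicit coordinates in the generators \<open>h\<close> and 2.\<close>

lemma in_max_obtain:
  assumes "in_max f"
  obtains q g where "f = h * q + (g + g)"
proof -
  obtain p where p: "red f = red h * p" using assms by (auto simp: in_max_def)
  obtain q where "red q = p" using red_surj by blast
  then have "red (f - h * q) = 0" by (simp add: red_diff red_mult p)
  then obtain g where "f - h * q = g + g" by (rule red_eq_0_half)
  then have "f = h * q + (g + g)" by (simp add: algebra_simps)
  then show ?thesis by (rule that)
qed

text \<open>In R the annihilator of 2 is 2R. If 2f = hq, then q vanishes modulo 2, as GF(2)[X] is a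
  domain, so q = 2g and 2(f - hg) = 0. Thus a factor 2 can be cancelled at the price of passing from
  R to the residue field.\<close>

lemma dvd_double_iff: "h dvd f + f \<longleftrightarrow> in_max f"
proof
  assume "h dvd f + f"
  then obtain q where q: "f + f = h * q" by blast
  have "red h * red q = red (f + f)" by (simp only: q red_mult)
  then have "red h * red q = 0" by (simp only: red_double)
  moreover have "red h \<noteq> 0" using prime_h2 by auto
  ultimately have "red q = 0" by simp
  then obtain g where "q = g + g" by (rule red_eq_0_half)
  then have "(f - h * g) + (f - h * g) = 0" using q by (simp add: algebra_simps)
  then have "red (f - h * g) = 0" by (simp add: red_eq_0_iff)
  then show "in_max f" by (simp add: in_max_def red_diff red_mult)
next
  assume "in_max f"
  then obtain q g where "f = h * q + (g + g)" by (rule in_max_obtain)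
  then have "f + f = h * (q + q) + 4 * g" by (simp add: algebra_simps)
  then show "h dvd f + f" by (simp only: four_eq_0 mult_zero_left add_0_right dvd_triv_left)
qed

text \<open>Modulo \<open>h\<close> such an element is 2g, and its square 4 g^2 vanishes.\<close>

lemma in_max_mult_square:
  assumes "in_max f"
  shows "h dvd f * f"
proof -
  obtain q g where "f = h * q + (g + g)" using in_max_obtain[OF assms] .
  then have "f * f = h * (q * f + q * (g + g)) + 4 * (g * g)"
    by (simp add: algebra_simps)
  then show ?thesis by (simp only: four_eq_0 mult_zero_left add_0_right dvd_triv_left)
qed

lemma not_in_max_1: "\<not> in_max 1"
proof -
  have "red 1 = 1" by (simp add: map_poly_1)
  then show ?thesis using prime_h2 by (simp only: in_max_def prime_elem_def) simp
qed

lemma monom_cong: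
  assumes "s mod n = t mod n"
  shows "h dvd monom 1 s - monom 1 t"
proof -
  have *: "h dvd monom 1 (t + k * n) - monom 1 t" for t k
  proof (induction k)
    case (Suc k)
    have "monom 1 (t + Suc k * n) - monom 1 t =
        (monom 1 n - 1) * monom 1 (t + k * n) + (monom 1 (t + k * n) - monom (1::4) t)"
      by (simp add: algebra_simps mult_monom)
    also have "h dvd \<dots>" using Suc h_dvd by (intro dvd_add dvd_mult2)
    finally show ?case .
  qed simp
  have "h dvd monom 1 s - monom 1 (s mod n)" "h dvd monom 1 t - monom 1 (t mod n)"
    using *[of "s mod n" "s div n"] *[of "t mod n" "t div n"] by simp_all
  then have "h dvd (monom 1 s - monom 1 (s mod n)) - (monom 1 t - monom 1 (t mod n))"
    by (rule dvd_diff)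
  then show ?thesis using assms by simp
qed

text \<open>By primitivity the n powers of X with exponent below n cover all n = 2^m - 1 nonzero
  residues, so no two of them can coincide: X has order exactly n in the residue field.\<close>

lemma in_max_monom_iff: "in_max (monom 1 s - monom 1 t) \<longleftrightarrow> s mod n = t mod n"
proof
  assume *: "in_max (monom 1 s - monom 1 t)"
  let ?P = "{p :: bit poly. degree p < m}"
  let ?f = "\<lambda>t. monom 1 t mod red h"
  have dvd: "red h dvd monom 1 i - monom 1 (i mod n)" for i
    using dvd_in_max[OF monom_cong[of i "i mod n"]] by (simp add: in_max_def red_diff red_monom)
  have "?P - {0} \<subseteq> ?f ` {..<n}"
  proof
    fix p :: "bit poly" assume p: "p \<in> ?P - {0}"
    then have "\<not> red h dvd p" using degree_h2 dvd_imp_degree_le[of "red h" p] by auto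
    then obtain k where "red h dvd p - monom 1 k"
      using primitive by (auto simp: primitive_irreducible_def)
    then have "red h dvd p - monom 1 (k mod n)"
      using dvd_add[OF _ dvd[of k]] by fastforce
    then have "p mod red h = ?f (k mod n)" by (simp add: mod_eq_dvd_iff)
    moreover have "p mod red h = p" using p degree_h2 by (simp add: mod_poly_less)
    ultimately show "p \<in> ?f ` {..<n}" using n_pos by (metis imageI lessThan_iff mod_less_divisor)
  qed
  then have "card (?P - {0}) \<le> card (?f ` {..<n})" by (rule card_mono[rotated]) simp
  moreover have "card (?P - {0}) = n"
    using card_degree_less[OF m_pos finite_bit] m_pos by (simp add: n_def card_bit)
  ultimately have "inj_on ?f {..<n}"
    using card_image_le[of "{..<n}" ?f] by (intro eq_card_imp_inj_on) auto
  moreover have "?f (s mod n) = ?f (t mod n)"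
  proof -
    have "red h dvd monom 1 s - monom 1 t" using * by (simp add: in_max_def red_diff red_monom)
    then show ?thesis using dvd[of s] dvd[of t] by (simp add: mod_eq_dvd_iff[symmetric])
  qed
  ultimately show "s mod n = t mod n" using n_pos by (auto dest: inj_onD)
qed (rule dvd_in_max[OF monom_cong])

lemma not_in_max_monom: "\<not> in_max (monom 1 t)"
proof
  assume "in_max (monom 1 t)"
  then have "in_max (monom 1 t * monom 1 (n * t - t))" by (rule in_max_mult)
  moreover have "monom 1 t * monom 1 (n * t - t) = monom (1::4) (t * n)"
    using n_pos by (cases n) (simp_all add: mult_monom algebra_simps)
  moreover have "in_max (monom 1 (t * n) - monom 1 0)"
    by (simp only: in_max_monom_iff mod_mult_self2_is_0 mod_0)
  ultimately show False using in_max_cong not_in_max_1 by (simp add: monom_eq_1)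
qed

lemma exists_monom:
  assumes "\<not> in_max f"
  obtains t where "in_max (f - monom 1 t)"
proof -
  obtain k where "red h dvd red f - monom 1 k"
    using assms primitive by (auto simp: primitive_irreducible_def in_max_def)
  then have "in_max (f - monom 1 k)" by (simp add: in_max_def red_diff red_monom)
  then show ?thesis by (rule that)
qed

text \<open>In \<open>GF(2\<^sup>m)\<close> with \<open>m\<close> odd there is no primitive cube root of unity.\<close>

lemma in_max_cube:
  assumes "in_max (x * x + x * y + y * y)"
  shows "in_max x"
proof (rule ccontr)
  assume x: "\<not> in_max x"
  have y: "\<not> in_max y"
  proof
    assume y: "in_max y"
    have "x * x = (x * x + x * y + y * y) - y * (x + y)" by (simp add: algebra_simps)
    then have "in_max (x * x)" using assms in_max_mult[OF y] in_max_diff by metis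
    then show False using x in_max_prime by blast
  qed
  obtain i where i: "in_max (x - monom 1 i)" using exists_monom[OF x] .
  obtain j where j: "in_max (y - monom 1 j)" using exists_monom[OF y] .
  let ?a = "monom 1 i :: 4 poly" and ?b = "monom 1 j :: 4 poly"
  \<comment> \<open>The difference of cubes x^3 - y^3 factors through x^2 + x y + y^2; the remaining
    terms replace \<open>x\<close> and \<open>y\<close> by powers of X.\<close>
  have "?a * ?a * ?a - ?b * ?b * ?b = (x * x + x * y + y * y) * (x - y)
      - (x - ?a) * (x * x + x * ?a + ?a * ?a) + (y - ?b) * (y * y + y * ?b + ?b * ?b)"
    by (simp add: algebra_simps)
  then have "in_max (?a * ?a * ?a - ?b * ?b * ?b)"
    using assms i j in_max_add in_max_diff in_max_mult by presburger
  then have "(i + i + i) mod n = (j + j + j) mod n" by (simp add: mult_monom in_max_monom_iff)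
  then have "[3 * i = 3 * j] (mod n)" by (simp add: cong_def numeral_eq_Suc add_ac)
  then have "[i = j] (mod n)" using coprime_3_n using cong_mult_lcancel_nat by blast
  then have "in_max (?a - ?b)" by (simp add: in_max_monom_iff cong_def)
  then have "in_max ((x - ?a) - (y - ?b) + (?a - ?b))" using i j in_max_add in_max_diff by blast
  then have d: "in_max (x - y)" by (simp add: algebra_simps)
  \<comment> \<open>With y equal to x in the residue field, the assumption becomes 3 x^2 = 0 there,
    that is x^2 = 0.\<close>
  have "x * x = (x * x + x * y + y * y) + (x - y) * (x + x + y) - (x * x + x * x)"
    by (simp add: algebra_simps)
  then have "in_max (x * x)"
    using assms in_max_mult[OF d] in_max_double[of "x * x"] in_max_add in_max_diff by metis
  then show False using x in_max_prime by blast
qed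

subsection \<open>Teichmueller representatives\<close>

text \<open>Zero and all powers of X represent, modulo \<open>h\<close>, the Teichmueller set of the
  Galois ring R; exponents are left unreduced, so equality in it appears as divisibility by
  \<open>h\<close>.\<close>

definition teich :: "4 poly set" where
  "teich = insert 0 (range (monom 1))"

text \<open>In the residue field and modulo \<open>h\<close> alike, two powers of X agree exactly if
  their exponents agree modulo n, and no power of X agrees with 0.\<close>

lemma teich_inj:
  assumes "a \<in> teich" "b \<in> teich" "in_max (a - b)"
  shows "h dvd a - b"
proof -
  have *: "\<not> in_max (0 - monom 1 t)" for t
    using not_in_max_monom[of t] in_max_cong[of 0 "monom 1 t"] by (auto simp: in_max_def)
  show ?thesis
    using assms * not_in_max_monom by (auto simp: teich_def in_max_monom_iff intro: monom_cong)
qed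

lemma teich_sqrt:
  assumes "a \<in> teich"
  obtains r where "r \<in> teich" "h dvd r * r - a"
proof (cases "a = 0")
  case True
  then show ?thesis by (intro that[of 0]) (simp_all add: teich_def)
next
  case False
  then obtain t where t: "a = monom 1 t" using assms by (auto simp: teich_def)
  \<comment> \<open>As \<open>n\<close> is odd, one of t and t + n is even, and both exponents give
    the same power of X modulo \<open>h\<close>.\<close>
  define s where "s = (if even t then t div 2 else (t + n) div 2)"
  have "s + s = t \<or> s + s = t + n" using odd_n unfolding s_def by presburger
  then have "h dvd monom 1 (s + s) - monom 1 t" by (intro monom_cong) auto
  then show ?thesis by (intro that[of "monom 1 s"]) (simp_all add: teich_def mult_monom t)
qed

lemma teich_exists: "\<exists>a\<in>teich. in_max (f - a)"
proof (cases "in_max f")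
  case True
  then show ?thesis by (intro bexI[of _ 0]) (simp_all add: teich_def)
next
  case False
  then obtain t where "in_max (f - monom 1 t)" by (rule exists_monom)
  then show ?thesis by (intro bexI[of _ "monom 1 t"]) (simp_all add: teich_def)
qed

text \<open>Square roots are taken first since squaring turns a congruence modulo 2 into one modulo 4.\<close>

lemma teich_sum_unique:
  assumes abcd: "a \<in> teich" "b \<in> teich" "c \<in> teich" "d \<in> teich"
    and sum: "h dvd a + b - (c + d)"
  shows "h dvd a - c \<or> h dvd a - d"
proof -
  obtain p where p: "p \<in> teich" "h dvd p * p - a" using teich_sqrt[OF abcd(1)] .
  obtain q where q: "q \<in> teich" "h dvd q * q - b" using teich_sqrt[OF abcd(2)] .
  obtain r where r: "r \<in> teich" "h dvd r * r - c" using teich_sqrt[OF abcd(3)] .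
  obtain s where s: "s \<in> teich" "h dvd s * s - d" using teich_sqrt[OF abcd(4)] .
  define u where "u = p + q - r - s"
  \<comment> \<open>\<open>w\<close> gathers the multiples of \<open>h\<close> at hand; it equals
    p^2 + q^2 - r^2 - s^2, so it is the square of \<open>u\<close> up to an even term, which puts
    \<open>u\<close> into the ideal.\<close>
  define w where "w = (p * p - a) + (q * q - b) - (r * r - c) - (s * s - d) + (a + b - (c + d))"
  have w: "h dvd w" unfolding w_def by (rule dvd_add[OF dvd_diff[OF dvd_diff[OF dvd_add[OF p(2) q(2)] r(2)] s(2)] sum])
  let ?e = "r * r + s * s + p * q + r * s - p * r - p * s - q * r - q * s"
  have "u * u = w + (?e + ?e)" unfolding u_def w_def by (simp add: algebra_simps)
  then have "in_max (u * u)" using dvd_in_max[OF w] in_max_double in_max_add by metis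
  then have u: "in_max u" using in_max_prime by blast
  \<comment> \<open>Comparing the squares of p + q and r + s + u modulo \<open>h\<close> isolates
    twice p q - r s, since both u^2 and 2 u vanish there.\<close>
  have "h dvd u * u + (u * (r + s) + u * (r + s)) - w"
    by (rule dvd_diff[OF dvd_add[OF in_max_mult_square[OF u] dvd_double_iff[THEN iffD2, OF in_max_mult[OF u]]] w])
  moreover have "u * u + (u * (r + s) + u * (r + s)) - w = (p * q - r * s) + (p * q - r * s)"
    unfolding u_def w_def by (simp add: algebra_simps)
  ultimately have "in_max (p * q - r * s)" by (simp only: dvd_double_iff)
  \<comment> \<open>In the residue field the pairs p, q and r, s now have equal sum and product, so
    p is a root of (Y - r)(Y - s).\<close>
  moreover have "(p - r) * (p - s) = u * p - (p * q - r * s)"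
    unfolding u_def by (simp add: algebra_simps)
  ultimately have "in_max ((p - r) * (p - s))" using in_max_mult[OF u] in_max_diff by metis
  then have "in_max (p - r) \<or> in_max (p - s)" by (rule in_max_prime)
  then have "h dvd p - r \<or> h dvd p - s" using teich_inj p r s by blast
  moreover have "a - c = (p - r) * (p + r) - (p * p - a) + (r * r - c)"
    "a - d = (p - s) * (p + s) - (p * p - a) + (s * s - d)"
    by (simp_all add: algebra_simps)
  ultimately show ?thesis using p(2) r(2) s(2) by (metis dvd_add dvd_diff dvd_mult2)
qed

text \<open>In the residue field the square roots have vanishing elementary symmetric functions of
  degrees 1 and 2. Eliminating \<open>s\<close> leaves x^2 + x y + y^2 = 0 for x = p + q and y = p +
  r, so \<open>in_max_cube\<close> yields p = q there.\<close>

lemma teich_sum_zero: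
  assumes abcd: "a \<in> teich" "b \<in> teich" "c \<in> teich" "d \<in> teich"
    and sum: "h dvd a + b + c + d"
  shows "h dvd a - b"
proof -
  obtain p where p: "p \<in> teich" "h dvd p * p - a" using teich_sqrt[OF abcd(1)] .
  obtain q where q: "q \<in> teich" "h dvd q * q - b" using teich_sqrt[OF abcd(2)] .
  obtain r where r: "r \<in> teich" "h dvd r * r - c" using teich_sqrt[OF abcd(3)] .
  obtain s where s: "s \<in> teich" "h dvd s * s - d" using teich_sqrt[OF abcd(4)] .
  define u where "u = p + q + r + s"
  define w where "w = (p * p - a) + (q * q - b) + (r * r - c) + (s * s - d) + (a + b + c + d)"
  have w: "h dvd w" unfolding w_def by (intro dvd_add[OF _ sum] dvd_add[OF _ s(2)] dvd_add[OF _ r(2)] dvd_add[OF _ q(2)] p)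
  let ?e = "p * q + p * r + p * s + q * r + q * s + r * s"
  have eq: "u * u = w + (?e + ?e)" unfolding u_def w_def by (simp add: algebra_simps)
  then have "in_max (u * u)" using dvd_in_max[OF w] in_max_double in_max_add by metis
  then have u: "in_max u" using in_max_prime by blast
  have "?e + ?e = u * u - w" using eq by simp
  then have "h dvd ?e + ?e" using in_max_mult_square[OF u] w by (metis dvd_diff)
  then have e: "in_max ?e" by (simp only: dvd_double_iff)
  let ?x = "p + q" and ?y = "p + r" and ?k = "p * p + p * q + p * r"
  have "?x * ?x + ?x * ?y + ?y * ?y = u * (p + q + r) + (?k + ?k) - ?e"
    unfolding u_def by (simp add: algebra_simps)
  then have "in_max (?x * ?x + ?x * ?y + ?y * ?y)"
    using in_max_mult[OF u] in_max_double[of ?k] e in_max_add in_max_diff by presburger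
  then have "in_max ?x" by (rule in_max_cube)
  moreover have "p - q = (p + q) - (q + q)" by simp
  ultimately have "in_max (p - q)" using in_max_double in_max_diff by metis
  then have "h dvd p - q" using teich_inj p q by blast
  moreover have "a - b = (p - q) * (p + q) - (p * p - a) + (q * q - b)"
    by (simp add: algebra_simps)
  ultimately show ?thesis using p(2) q(2) by (metis dvd_add dvd_diff dvd_mult2)
qed

end

subsection \<open>Words, Lee weights and syndromes\<close>

lemma gray_inj: "gray c = gray d \<Longrightarrow> c = d"
proof
  fix t assume "gray c = gray d"
  then have "gray_beta (c t) = gray_beta (d t)" "gray_gamma (c t) = gray_gamma (d t)"
    by (auto simp: gray_def fun_eq_iff)
  then show "c t = d t"
    using Z4_cases[of "c t"] Z4_cases[of "d t"]
    by (auto simp: gray_beta_def gray_gamma_def)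
qed

lemma lee_eq_iff: "lee a = 0 \<longleftrightarrow> a = 0" "lee a = Suc 0 \<longleftrightarrow> a = 1 \<or> a = 3"
  using Z4_cases[of a] by (auto simp: lee_def)

lemma lee_weight_eq_0:
  assumes "z \<in> words L" "lee_weight L z = 0"
  shows "z = 0"
proof
  fix t
  have "t < L \<Longrightarrow> z t = 0" using assms(2) by (simp add: lee_weight_def lee_eq_iff)
  then show "z t = 0 t" using assms(1) by (cases "t < L") (simp_all add: words_def)
qed

lemma lee_weight_eq_1:
  assumes "z \<in> words L" "lee_weight L z = 1"
  obtains t a where "t < L" "a = 1 \<or> a = 3" "z = (\<lambda>_. 0)(t := a)"
proof -
  obtain t where t: "t < L" "lee (z t) = 1" "\<And>i. i < L \<Longrightarrow> i \<noteq> t \<Longrightarrow> lee (z i) = 0"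
    using iffD1[OF sum_eq_1_iff, OF _ assms(2)[unfolded lee_weight_def]] by auto
  have "z i = ((\<lambda>_. 0)(t := z t)) i" for i
    using t(3)[of i] assms(1) by (cases "i < L") (auto simp: lee_eq_iff words_def)
  then have "z = (\<lambda>_. 0)(t := z t)" by blast
  then show ?thesis using t(1,2) by (intro that[of t "z t"]) (simp_all add: lee_eq_iff)
qed

lemma lee_weight_single:
  assumes "t < L" "a = 1 \<or> a = 3"
  shows "lee_weight L ((\<lambda>_. 0)(t := a)) = 1"
proof -
  have "lee_weight L ((\<lambda>_. 0)(t := a)) = (\<Sum>i<L. if i = t then 1 else 0)"
    unfolding lee_weight_def using assms(2) by (intro sum.cong) (auto simp: lee_def)
  then show ?thesis using assms(1) by simp
qed

lemma words_plus: "x \<in> words L \<Longrightarrow> y \<in> words L \<Longrightarrow> x + y \<in> words L"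
  and words_minus: "x \<in> words L \<Longrightarrow> y \<in> words L \<Longrightarrow> x - y \<in> words L"
  by (simp_all add: words_def)

section \<open>Canonical remainders and the ring R\<close>

context teichmueller
begin

text \<open>Choosing the remainder of degree below m turns classes modulo \<open>h\<close> into
  single polynomials; as \<open>res\<close> is additive, addition in R is polynomial
  addition.\<close>

definition res :: "4 poly \<Rightarrow> 4 poly" where
  "res f = (SOME r. degree r < m \<and> h dvd f - r)"

lemma degree_res: "degree (res f) < m" and dvd_res: "h dvd f - res f"
proof -
  have "\<exists>r. degree r < m \<and> h dvd f - r"
    using monic_rem_exists[of h f] monic degree_h m_pos by simp
  then have "degree (res f) < m \<and> h dvd f - res f" unfolding res_def by (rule someI_ex)
  then show "degree (res f) < m" "h dvd f - res f" by simp_all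
qed

lemma res_unique:
  assumes "degree r < m" "h dvd f - r"
  shows "res f = r"
proof -
  have "h dvd (f - r) - (f - res f)" by (rule dvd_diff[OF assms(2) dvd_res])
  then have "h dvd res f - r" by simp
  moreover have "degree (res f - r) < degree h"
    using assms(1) degree_res degree_h by (simp add: degree_diff_less)
  ultimately show ?thesis using monic_dvd_degree_less[OF monic] by fastforce
qed

lemma res_eq_iff: "res f = res g \<longleftrightarrow> h dvd f - g"
proof
  assume "res f = res g"
  then have "h dvd (f - res f) - (g - res f)" using dvd_diff[OF dvd_res[of f] dvd_res[of g]] by simp
  then show "h dvd f - g" by simp
next
  assume "h dvd f - g"
  from dvd_add[OF this dvd_res[of g]] have "h dvd f - res g" by simp
  then show "res f = res g" by (rule res_unique[OF degree_res])
qed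

lemma res_add: "res (f + g) = res f + res g"
proof (rule res_unique)
  show "degree (res f + res g) < m" by (intro degree_add_less degree_res)
  have "h dvd (f - res f) + (g - res g)" by (intro dvd_add dvd_res)
  then show "h dvd f + g - (res f + res g)" by (simp add: algebra_simps)
qed

lemma res_diff: "res (f - g) = res f - res g"
  using res_add[of "f - g" g] by simp

lemma res_id: "degree r < m \<Longrightarrow> res r = r"
  by (rule res_unique) simp_all

lemma res_0: "res 0 = 0"
  by (rule res_id) (simp add: m_pos)

lemma res_uminus: "res (- f) = - res f"
  using res_diff[of 0 f] by (simp add: res_0)

lemma res_eq_0_iff: "res f = 0 \<longleftrightarrow> h dvd f"
  using res_eq_iff[of f 0] by (simp add: res_0)

definition T where "T = res ` teich"

lemma T_sum:
  assumes "a \<in> T" "b \<in> T" "c \<in> T" "d \<in> T" "a + b = c + d"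
  shows "c = a \<or> c = b"
proof -
  obtain a' b' c' d' where *: "a' \<in> teich" "b' \<in> teich" "c' \<in> teich" "d' \<in> teich"
    "a = res a'" "b = res b'" "c = res c'" "d = res d'"
    using assms(1-4) unfolding T_def by blast
  then have "h dvd c' + d' - (a' + b')" using assms(5) by (simp flip: res_eq_iff add: res_add)
  then show ?thesis using teich_sum_unique[of c' d' a' b'] * by (simp add: res_eq_iff)
qed

lemma T_sum_zero:
  assumes "a \<in> T" "b \<in> T" "c \<in> T" "d \<in> T" "a + b + c + d = 0"
  shows "a = b"
proof -
  obtain a' b' c' d' where *: "a' \<in> teich" "b' \<in> teich" "c' \<in> teich" "d' \<in> teich"
    "a = res a'" "b = res b'" "c = res c'" "d = res d'"
    using assms(1-4) unfolding T_def by blast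
  then have "h dvd a' + b' + c' + d'" using assms(5) by (simp flip: res_eq_0_iff add: res_add)
  then show ?thesis using teich_sum_zero[of a' b' c' d'] * by (simp add: res_eq_iff)
qed

lemma T_inj:
  assumes "a \<in> T" "b \<in> T" "in_max (a - b)"
  shows "a = b"
proof -
  obtain a' b' where *: "a' \<in> teich" "b' \<in> teich" "a = res a'" "b = res b'"
    using assms(1,2) unfolding T_def by blast
  have "in_max ((a - b) + (a' - res a') - (b' - res b'))"
    using assms(3) dvd_in_max[OF dvd_res] in_max_add in_max_diff by blast
  then show ?thesis using teich_inj[of a' b'] * by (simp add: res_eq_iff)
qed

lemma T_exists: "\<exists>a\<in>T. in_max (f - a)"
proof -
  obtain a where "a \<in> teich" "in_max (f - a)" using teich_exists by blast
  moreover from this have "in_max ((f - a) + (a - res a))"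
    using dvd_in_max[OF dvd_res] in_max_add by blast
  ultimately show ?thesis by (auto simp: T_def)
qed

lemma T_eq: "T = insert 0 ((\<lambda>t. res (monom 1 t)) ` {..<n})"
proof -
  have "res (monom 1 t) = res (monom 1 (t mod n))" for t
    unfolding res_eq_iff by (rule monom_cong) simp
  then have "res (monom 1 t) \<in> (\<lambda>t. res (monom 1 t)) ` {..<n}" for t
    using n_pos by (metis imageI lessThan_iff mod_less_divisor)
  then show ?thesis by (auto simp: T_def teich_def res_0)
qed

lemma card_T: "card T = 2 ^ m" and finite_T: "finite T"
proof -
  have "inj_on (\<lambda>t. res (monom 1 t)) {..<n}"
    by (auto intro!: inj_onI simp: res_eq_iff dest!: dvd_in_max simp: in_max_monom_iff)
  moreover have "res (monom 1 t) \<noteq> 0" for t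
    using not_in_max_monom dvd_in_max res_eq_0_iff by blast
  then have "0 \<notin> (\<lambda>t. res (monom 1 t)) ` {..<n}" by fastforce
  ultimately show "card T = 2 ^ m" by (simp add: T_eq card_image Suc_n)
  show "finite T" by (simp add: T_eq)
qed

definition R where "R = {r :: 4 poly. degree r < m}"

lemma card_R: "card R = 4 ^ m" and finite_R: "finite R"
  using card_degree_less[where 'a = 4, OF m_pos] by (simp_all add: R_def)

lemma R_add: "a \<in> R \<Longrightarrow> b \<in> R \<Longrightarrow> a + b \<in> R"
  and R_diff: "a \<in> R \<Longrightarrow> b \<in> R \<Longrightarrow> a - b \<in> R"
  and R_uminus: "a \<in> R \<Longrightarrow> - a \<in> R"
  and R_0: "0 \<in> R"
  using m_pos by (simp_all add: R_def degree_add_less degree_diff_less)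

lemma T_R: "a \<in> T \<Longrightarrow> a \<in> R"
  using degree_res by (auto simp: T_def R_def)

section \<open>The group, its distinguished subsets and their axioms\<close>

definition G :: "(4 \<times> 4 poly) set" where "G = UNIV \<times> R"
definition E :: "(4 \<times> 4 poly) set" where "E = {0, 2} \<times> R"
definition K :: "(4 \<times> 4 poly) set" where "K = {0} \<times> {r \<in> R. in_max r}"
definition S :: "(4 \<times> 4 poly) set" where "S = {1} \<times> T \<union> {3} \<times> uminus ` T"

lemma S_cases:
  assumes "s \<in> S"
  obtains a where "a \<in> T" "s = (1, a)" | a where "a \<in> T" "s = (3, - a)"
  using assms by (auto simp: S_def)

text \<open>The first coordinates in Z_4 decide which signs can match. Equal signs throughout give
  \<open>a + b = c + d\<close>, two plus against two minus signs give
  \<open>a + b + (c + d) = 0\<close> because 1 + 1 = 3 + 3, and mixed signs rearrange to an equality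
  of sums of two elements of \<open>T\<close> again.\<close>

lemma sidon_S:
  assumes "s \<in> S" "t \<in> S" "s' \<in> S" "t' \<in> S" and eq: "s + t = s' + t'" and nz: "s + t \<noteq> 0"
  shows "s' = s \<or> s' = t \<or> s = t \<and> s' = - s"
proof -
  obtain a where a: "a \<in> T" "s = (1, a) \<or> s = (3, - a)" using assms(1) by (rule S_cases) auto
  obtain b where b: "b \<in> T" "t = (1, b) \<or> t = (3, - b)" using assms(2) by (rule S_cases) auto
  obtain c where c: "c \<in> T" "s' = (1, c) \<or> s' = (3, - c)" using assms(3) by (rule S_cases) auto
  obtain d where d: "d \<in> T" "t' = (1, d) \<or> t' = (3, - d)" using assms(4) by (rule S_cases) auto
  have same: "c = a \<or> c = b" if "a + b = c + d" using T_sum a b c d that by blast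
  \<comment> \<open>A vanishing sum is symmetric, so \<open>T_sum_zero\<close> applies to any pair;
    then \<open>s = t\<close> and \<open>s'\<close> is \<open>- s\<close>, the exceptional
    case.\<close>
  have opp: "a = b \<and> a = c" if "a + b + (c + d) = 0"
    using T_sum_zero[of a b c d] T_sum_zero[of a c b d] a b c d that by (simp add: add_ac)
  have cross1: "c = a \<or> a = b" if "a + d = c + b" using T_sum[of a d c b] a b c d that by auto
  have cross2: "c = b \<or> a = b" if "a + c = b + d" using T_sum[of b d a c] a b c d that by auto
  consider "s = (1, a)" "t = (1, b)" | "s = (3, - a)" "t = (3, - b)"
    | "s = (1, a)" "t = (3, - b)" | "s = (3, - a)" "t = (1, b)" using a(2) b(2) by blast
  then show ?thesis
  proof cases
    case 1
    then consider "s' = (1, c)" "a + b = c + d" | "s' = (3, - c)" "a + b = - (c + d)"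
      using c(2) d(2) eq by auto
    then show ?thesis using same opp 1 by cases auto
  next
    case 2
    then consider (neg) "s' = (3, - c)" "- a - b = - c - d" | (pos) "s' = (1, c)" "- a - b = c + d"
      using c(2) d(2) eq by auto
    then show ?thesis
    proof cases
      case neg
      from arg_cong[OF neg(2), of uminus] have "a + b = c + d" by (simp add: add.commute)
      then show ?thesis using same 2 neg(1) by auto
    next
      case pos
      then have "a + b + (c + d) = 0" by (simp flip: pos(2))
      then show ?thesis using opp 2 pos(1) by auto
    qed
  next
    case 3
    then have "a \<noteq> b" using nz by (auto simp: zero_prod_def)
    from 3 consider "s' = (1, c)" "a + d = c + b" | "s' = (3, - c)" "a + c = b + d"
      using c(2) d(2) eq by (auto simp: algebra_simps)
    then show ?thesis using cross1 cross2 3 \<open>a \<noteq> b\<close> by cases auto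
  next
    case 4
    then have "a \<noteq> b" using nz by (auto simp: zero_prod_def)
    from 4 consider "s' = (3, - c)" "a + d = c + b" | "s' = (1, c)" "a + c = b + d"
      using c(2) d(2) eq by (auto simp: algebra_simps)
    then show ?thesis using cross1 cross2 4 \<open>a \<noteq> b\<close> by cases auto
  qed
qed

text \<open>\<open>T\<close> is a transversal of 2R in R, so exactly one of its elements is
  congruent to \<open>r\<close>, respectively to \<open>- r\<close>; the first coordinate fixes the
  sign of \<open>s\<close>.\<close>

lemma perfect_S:
  assumes "x \<in> G - E"
  shows "\<exists>!s. s \<in> S \<and> x + s \<in> K"
proof -
  obtain e r where x: "x = (e, r)" "r \<in> R" "e = 1 \<or> e = 3"
    using assms Z4_cases[of "fst x"] by (cases x) (auto simp: G_def E_def)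
  from x(3) show ?thesis
  proof
    assume e: "e = 1"
    obtain a where a: "a \<in> T" "in_max (r - a)" using T_exists by blast
    show ?thesis
    proof
      show "(3, - a) \<in> S \<and> x + (3, - a) \<in> K"
        using a x e T_R R_diff by (simp add: S_def K_def)
      fix s assume s: "s \<in> S \<and> x + s \<in> K"
      then obtain b where b: "b \<in> T" "s = (3, - b)" "in_max (r - b)"
        using x e by (auto simp: S_def K_def)
      have "in_max ((r - b) - (r - a))" using a b in_max_diff by blast
      then show "s = (3, - a)" using T_inj[of a b] a b by simp
    qed
  next
    assume e: "e = 3"
    obtain a where a: "a \<in> T" "in_max (- r - a)" using T_exists by blast
    then have a': "in_max (r + a)" using in_max_diff[of 0 "- r - a"] by (simp add: in_max_def algebra_simps)
    show ?thesis
    proof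
      show "(1, a) \<in> S \<and> x + (1, a) \<in> K"
        using a a' x e T_R R_add by (simp add: S_def K_def)
      fix s assume s: "s \<in> S \<and> x + s \<in> K"
      then obtain b where b: "b \<in> T" "s = (1, b)" "in_max (r + b)"
        using x e by (auto simp: S_def K_def)
      have "in_max ((r + a) - (r + b))" using a' b in_max_diff by blast
      then show "s = (1, a)" using T_inj[of a b] a b by simp
    qed
  qed
qed

lemma antipodal: "antipodal_cayley G E K S (2 ^ (m + 1))"
proof
  show "finite G" using finite_R by (simp add: G_def)
  have "card S = card ({1 :: 4} \<times> T) + card ({3 :: 4} \<times> uminus ` T)"
    unfolding S_def using finite_T by (intro card_Un_disjoint) auto
  then show "card S = 2 ^ (m + 1)" by (simp add: card_cartesian_product card_image card_T)
  have "(4::nat) ^ m = 2 ^ m * 2 ^ m" by (simp flip: power_mult_distrib)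
  then show "2 * card E = 2 ^ (m + 1) * 2 ^ (m + 1)" by (simp add: E_def card_cartesian_product card_R)
  moreover have "G - E = {1, 3} \<times> R" using Z4_cases by (auto simp: G_def E_def)
  ultimately show "2 * card (G - E) = 2 ^ (m + 1) * 2 ^ (m + 1)"
    by (simp add: E_def card_cartesian_product card_R)
  show "0 \<in> K" "K \<subseteq> E" "E \<subseteq> G" using R_0 by (auto simp: K_def E_def G_def in_max_def zero_prod_def)
  show "S \<subseteq> G - E" using T_R R_uminus by (auto simp: S_def E_def G_def)
  show "x - y \<in> G" if "x \<in> G" "y \<in> G" for x y
    using that R_diff by (auto simp: G_def)
  show "- s \<in> S" if "s \<in> S" for s
    using that by (auto simp: S_def)
  show "x + s \<in> E \<longleftrightarrow> x \<notin> E" if "x \<in> G" "s \<in> S" for x s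
  proof -
    obtain e r where x: "x = (e, r)" "r \<in> R" using \<open>x \<in> G\<close> by (auto simp: G_def)
    have "snd s \<in> R" "fst s = 1 \<or> fst s = 3" using \<open>s \<in> S\<close> T_R R_uminus by (auto simp: S_def)
    then show ?thesis
      using x R_add[of r "snd s"] Z4_cases[of e] by (cases s) (auto simp: E_def)
  qed
  have "2 ^ (1 + 1) \<le> (2::nat) ^ (m + 1)" using m_pos by (intro power_increasing) auto
  then show "4 \<le> (2::nat) ^ (m + 1)" by simp
qed (use perfect_S sidon_S in blast)+

section \<open>Syndromes and cosets of the code\<close>

definition syn :: "(nat \<Rightarrow> 4) \<Rightarrow> 4 \<times> 4 poly" where
  "syn x = (\<Sum>t<Suc n. x t, res (\<Sum>t<n. monom (x t) t))"

lemma syn_add: "syn (x + y) = syn x + syn y"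
  by (simp add: syn_def sum.distrib flip: add_monom res_add)

lemma syn_diff: "syn (x - y) = syn x - syn y"
  using syn_add[of "x - y" y] by simp

lemma syn_G: "syn x \<in> G"
  by (simp add: syn_def G_def R_def degree_res)

text \<open>The check position contributes 0 to the second coordinate and so stands for the element
  0 of the Teichmueller set, while position t < n stands for X^t.\<close>

lemma syn_single:
  assumes "t < Suc n"
  shows "syn ((\<lambda>_. 0)(t := a)) = (a, if t < n then res (monom a t) else 0)"
proof -
  have "(\<Sum>i<Suc n. ((\<lambda>_. 0)(t := a)) i) = (\<Sum>i<Suc n. if i = t then a else 0)"
    by (rule sum.cong) auto
  also have "\<dots> = a" using assms by simp
  finally have 1: "(\<Sum>i<Suc n. ((\<lambda>_. 0)(t := a)) i) = a" .
  have "(\<Sum>i<n. monom (((\<lambda>_. 0)(t := a)) i) i) = (\<Sum>i<n. if i = t then monom a t else 0)"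
    by (rule sum.cong) auto
  also have "\<dots> = (if t < n then monom a t else 0)" by simp
  finally show ?thesis using 1 by (simp add: syn_def res_0)
qed

lemma syn_surj:
  assumes "g \<in> G"
  obtains x where "x \<in> words (Suc n)" "syn x = g"
proof -
  obtain e r where g: "g = (e, r)" "degree r < m" using assms by (auto simp: G_def R_def)
  have "m < 2 ^ m" by (rule less_exp)
  then have "degree r < n" using g(2) n_def by linarith
  \<comment> \<open>The entries before n are the coefficients of \<open>r\<close>, which fit because
    degree r < m <= n, and position n corrects the total to \<open>e\<close>.\<close>
  define x where "x t = (if t < n then coeff r t else if t = n then e - (\<Sum>t<n. coeff r t) else 0)" for t
  have "x \<in> words (Suc n)" by (simp add: words_def x_def)
  moreover have "syn x = g"
  proof -
    have "(\<Sum>t<Suc n. x t) = e" by (simp add: x_def)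
    moreover have "(\<Sum>t<n. monom (x t) t) = (\<Sum>t<n. monom (coeff r t) t)"
      by (intro sum.cong) (simp_all add: x_def)
    moreover have "\<dots> = r"
      using poly_as_sum_of_monoms'[of r "n - 1"] \<open>degree r < n\<close>
      by (cases n) (simp_all add: lessThan_Suc_atMost)
    ultimately show ?thesis using g res_id by (simp add: syn_def)
  qed
  ultimately show ?thesis by (rule that)
qed

text \<open>As \<open>h\<close> divides X^n - 1, the ideal it generates modulo X^n - 1 consists of
  the multiples of \<open>h\<close>, and the check coordinate makes the total zero. Hence the code
  is the kernel of \<open>syn\<close>.\<close>

lemma preparata_eq: "preparata m h = {x \<in> words (Suc n). syn x = 0}"
proof (intro equalityI subsetI)
  fix x assume "x \<in> preparata m h"
  then obtain c q where c: "c \<in> words n" "x = adjoin_check n c"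
    and q: "monom 1 n - 1 dvd (\<Sum>t<n. monom (c t) t) - h * q"
    unfolding preparata_def cyclic_code_def n_def by blast
  have "h dvd ((\<Sum>t<n. monom (c t) t) - h * q) + h * q"
    using dvd_trans[OF h_dvd q] by (intro dvd_add dvd_triv_left)
  moreover have "(\<Sum>t<n. monom (x t) t) = (\<Sum>t<n. monom (c t) t)"
    by (intro sum.cong) (simp_all add: c(2) adjoin_check_def)
  moreover have "(\<Sum>t<n. x t) = (\<Sum>t<n. c t)"
    by (intro sum.cong) (simp_all add: c(2) adjoin_check_def)
  moreover have "x n = - (\<Sum>t<n. c t)" by (simp add: c(2) adjoin_check_def)
  moreover have "x \<in> words (Suc n)" using c by (auto simp: words_def adjoin_check_def)
  ultimately show "x \<in> {x \<in> words (Suc n). syn x = 0}"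
    by (simp add: syn_def res_eq_0_iff zero_prod_def)
next
  fix x assume "x \<in> {x \<in> words (Suc n). syn x = 0}"
  then have x: "x \<in> words (Suc n)" "(\<Sum>t<n. x t) + x n = 0" "h dvd (\<Sum>t<n. monom (x t) t)"
    by (simp_all add: syn_def res_eq_0_iff zero_prod_def)
  define c where "c = x(n := 0)"
  have *: "(\<Sum>t<n. monom (c t) t) = (\<Sum>t<n. monom (x t) t)" "(\<Sum>t<n. c t) = (\<Sum>t<n. x t)"
    by (intro sum.cong; simp add: c_def)+
  obtain q where "(\<Sum>t<n. monom (x t) t) = h * q" using x(3) by blast
  then have "monom 1 n - 1 dvd (\<Sum>t<n. monom (c t) t) - h * q" using * by simp
  moreover have "c t = 0" if "t \<ge> n" for t
    using x(1) that by (cases "t = n") (simp_all add: words_def c_def)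
  then have "c \<in> words n" by (simp add: words_def)
  ultimately have "c \<in> cyclic_code n h" unfolding cyclic_code_def by blast
  moreover have "x = adjoin_check n c"
    using x(2) * by (auto simp: adjoin_check_def c_def fun_eq_iff add_eq_0_iff)
  ultimately show "x \<in> preparata m h" unfolding preparata_def n_def by blast
qed

definition coset :: "4 \<times> 4 poly \<Rightarrow> (nat \<Rightarrow> 4) set" where
  "coset g = {x \<in> words (Suc n). syn x = g}"

lemma coset_syn:
  assumes "x \<in> words (Suc n)"
  shows "x +o preparata m h = coset (syn x)"
proof (intro equalityI subsetI)
  fix z assume "z \<in> x +o preparata m h"
  then show "z \<in> coset (syn x)"
    using assms words_plus by (auto simp: elt_set_plus_def preparata_eq coset_def syn_add)
next
  fix z assume "z \<in> coset (syn x)"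
  then have "z - x \<in> preparata m h" "z = x + (z - x)"
    using assms words_minus by (simp_all add: preparata_eq coset_def syn_diff)
  then show "z \<in> x +o preparata m h" unfolding elt_set_plus_def by blast
qed

text \<open>Words of Lee weight 1 have a single nonzero entry, 1 or 3, and their syndromes run
  through exactly \<open>S\<close>; weight 0 belongs to the zero syndrome, which is not in
  \<open>S\<close>.\<close>

lemma min_lee_weight_coset:
  assumes "g \<in> G"
  shows "min_lee_weight (Suc n) (coset g) = 1 \<longleftrightarrow> g \<in> S"
proof
  assume *: "min_lee_weight (Suc n) (coset g) = 1"
  have "coset g \<noteq> {}" using syn_surj[OF assms] by (fastforce simp: coset_def)
  then have "min_lee_weight (Suc n) (coset g) \<in> lee_weight (Suc n) ` coset g"
    unfolding min_lee_weight_def by (intro Inf_nat_def1) simp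
  then obtain z where z: "z \<in> words (Suc n)" "syn z = g" "lee_weight (Suc n) z = 1"
    using * by (auto simp: coset_def)
  obtain t a where t: "t < Suc n" "a = 1 \<or> a = 3" "z = (\<lambda>_. 0)(t := a)"
    using lee_weight_eq_1[OF z(1,3)] .
  define r where "r = (if t < n then res (monom 1 t) else 0)"
  have "monom 3 t = - monom (1::4) t" by (simp add: minus_monom)
  then have "g = (1, r) \<or> g = (3, - r)"
    using syn_single[OF t(1), of a] t(2,3) z(2) by (auto simp: r_def res_uminus)
  moreover have "r \<in> T" by (simp add: r_def T_eq)
  ultimately show "g \<in> S" by (auto simp: S_def)
next
  assume g: "g \<in> S"
  have "\<exists>t a. t < Suc n \<and> (a = 1 \<or> a = 3) \<and> syn ((\<lambda>_. 0)(t := a)) = g"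
  proof -
    have *: "\<exists>t<Suc n. r = (if t < n then res (monom 1 t) else 0)" if "r \<in> T" for r
    proof (cases "r = 0")
      case True
      then show ?thesis by (intro exI[of _ n]) simp
    next
      case False
      then show ?thesis using that by (auto simp: T_eq intro: exI less_SucI)
    qed
    from g show ?thesis
    proof (cases rule: S_cases)
      case (1 r)
      then obtain t where "t < Suc n" "r = (if t < n then res (monom 1 t) else 0)" using * by blast
      then show ?thesis using 1 by (intro exI[of _ t] exI[of _ 1]) (simp add: syn_single)
    next
      case (2 r)
      then obtain t where "t < Suc n" "r = (if t < n then res (monom 1 t) else 0)" using * by blast
      moreover have "monom 3 t = - monom (1::4) t" by (simp add: minus_monom)
      ultimately show ?thesis
        using 2 by (intro exI[of _ t] exI[of _ 3]) (simp add: syn_single res_uminus)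
    qed
  qed
  then obtain t a where t: "t < Suc n" "a = 1 \<or> a = 3" "syn ((\<lambda>_. 0)(t := a)) = g" by blast
  let ?z = "(\<lambda>_. 0)(t := a)"
  have z: "?z \<in> coset g" using t by (auto simp: coset_def words_def)
  then have "min_lee_weight (Suc n) (coset g) \<le> lee_weight (Suc n) ?z"
    unfolding min_lee_weight_def by (intro cINF_lower) auto
  then have "min_lee_weight (Suc n) (coset g) \<le> 1" using lee_weight_single[OF t(1,2)] by simp
  moreover have "min_lee_weight (Suc n) (coset g) \<noteq> 0"
  proof
    assume "min_lee_weight (Suc n) (coset g) = 0"
    moreover have "min_lee_weight (Suc n) (coset g) \<in> lee_weight (Suc n) ` coset g"
      unfolding min_lee_weight_def using z by (intro Inf_nat_def1) blast
    ultimately obtain y where "y \<in> words (Suc n)" "syn y = g" "lee_weight (Suc n) y = 0"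
      by (auto simp: coset_def)
    then have "g = syn 0" using lee_weight_eq_0 by blast
    also have "\<dots> = 0" using syn_diff[of 0 0] by simp
    finally show False using g by (auto simp: S_def zero_prod_def)
  qed
  ultimately show "min_lee_weight (Suc n) (coset g) = 1" by linarith
qed

section \<open>Identification of the graph\<close>

lemma gray_coset_eq_iff:
  assumes "g \<in> G"
  shows "gray ` coset g = gray ` coset k \<longleftrightarrow> g = k"
proof
  assume "gray ` coset g = gray ` coset k"
  then have "coset g = coset k" using gray_inj by (simp add: inj_image_eq_iff inj_def)
  moreover obtain x where "x \<in> coset g" using syn_surj[OF assms] by (fastforce simp: coset_def)
  ultimately show "g = k" by (auto simp: coset_def)
qed simp

text \<open>Adjacency asks for some representatives, but the syndromes of \<open>x\<close> and
  \<open>y\<close> are fixed by their cosets, so the choice is immaterial and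
  \<open>min_lee_weight_coset\<close> applies to the difference.\<close>

lemma gamma_adj_coset:
  assumes "g \<in> G" "k \<in> G"
  shows "gamma_adj m h (gray ` coset g) (gray ` coset k) \<longleftrightarrow> g - k \<in> S"
proof -
  have "gamma_adj m h (gray ` coset g) (gray ` coset k) \<longleftrightarrow>
    (\<exists>x\<in>words (Suc n). \<exists>y\<in>words (Suc n). g = syn x \<and> k = syn y \<and> syn x - syn y \<in> S)"
    unfolding gamma_adj_def Suc_n[symmetric]
    using assms min_lee_weight_coset[OF syn_G]
    by (intro bex_cong refl) (simp add: coset_syn words_minus gray_coset_eq_iff syn_G syn_diff[symmetric])
  also have "\<dots> \<longleftrightarrow> g - k \<in> S"
    using syn_surj[OF assms(1)] syn_surj[OF assms(2)] by metis
  finally show ?thesis .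
qed

lemma gamma_verts_eq: "gamma_verts m h = (\<lambda>g. gray ` coset g) ` G"
proof (intro equalityI subsetI)
  fix u assume "u \<in> gamma_verts m h"
  then obtain x where "x \<in> words (Suc n)" "u = gray ` coset (syn x)"
    unfolding gamma_verts_def Suc_n[symmetric] using coset_syn by blast
  then show "u \<in> (\<lambda>g. gray ` coset g) ` G" using syn_G by blast
next
  fix u assume "u \<in> (\<lambda>g. gray ` coset g) ` G"
  then obtain g where g: "g \<in> G" "u = gray ` coset g" by blast
  then obtain x where "x \<in> words (Suc n)" "syn x = g" using syn_surj by blast
  then show "u \<in> gamma_verts m h"
    unfolding gamma_verts_def Suc_n[symmetric] using g coset_syn by blast
qed

sublocale antipodal_cayley_graph G E K S "2 ^ (m + 1)" "gamma_verts m h" "gamma_adj m h"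
  "\<lambda>g. gray ` coset g"
proof (intro antipodal_cayley_graph.intro antipodal antipodal_cayley_graph_axioms.intro)
  show "bij_betw (\<lambda>g. gray ` coset g) G (gamma_verts m h)"
    unfolding bij_betw_def gamma_verts_eq using gray_coset_eq_iff by (auto intro: inj_onI)
  show "u \<in> gamma_verts m h \<and> w \<in> gamma_verts m h" if "gamma_adj m h u w" for u w
    using that unfolding gamma_adj_def gamma_verts_def by blast
qed (rule gamma_adj_coset)

end

theorem theorem23:
  fixes m N :: nat and h2 :: "bit poly" and h :: "4 poly"
  assumes "odd m" and "m \<ge> 3" and "N = 2 ^ (m + 1)"
    and "primitive_irreducible h2" and "degree h2 = m"
    and "lead_coeff h = 1" and "degree h = m" and "map_poly red2 h = h2"
    and "h dvd monom 1 (2 ^ m - 1) - 1"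
  defines "V \<equiv> gamma_verts m h" and "adj \<equiv> gamma_adj m h"
  shows "has_diameter V adj 4
    \<and> has_valency V adj 0 1
    \<and> has_valency V adj 1 N
    \<and> has_valency V adj 2 (N choose 2)
    \<and> has_valency V adj 3 (N * (N - 2) div 2)
    \<and> has_valency V adj 4 ((N - 2) div 2)
    \<and> has_b V adj 0 N
    \<and> has_c V adj 1 1 \<and> has_b V adj 1 (N - 1)
    \<and> has_c V adj 2 2 \<and> has_b V adj 2 (N - 2)
    \<and> has_c V adj 3 (N - 1) \<and> has_b V adj 3 1
    \<and> has_c V adj 4 N
    \<and> (\<forall>j\<le>4. has_a V adj j 0)"
proof -
  interpret teichmueller m "2 ^ m - 1" h
    using assms by unfold_locales auto
  show ?thesis using parameters assms(3) unfolding V_def adj_def by simp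
qed

end
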